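(* Let $k_0\ge 1$ and suppose that, for each $n$, the network $\mathbf{A}_{n\times n}$ is generated from a stochastic block model with $k_0$ communities and parameters $\pi_0\in\Pi^{k_0}$ and $P_0=\rho_n S_0\in\mathcal P^{k_0}$, where $S_0$ is a fixed matrix not depending on $n$, $P_0$ has no two identical columns, and either $\rho_n\to 0$ and $n\rho_n\to\infty$ as $n\to\infty$, or $\rho_n=1$ for all $n$. Let $\epsilon>0$ and let $$\mathrm{pen}(k,n)=\sum_{i=1}^{k-1}\left(\frac{i(i+2)+1+\epsilon}{2}\right)\log n+n\sum_{i=1}^{k-1}\log i .$$ Then the estimators $$\hat k_{\mathrm{DNML}}(\mathbf{A}_{n\times n})=\arg\max_{1\le k\le n}\left\{\log \mathrm{DNML}_k(\mathbf{A}_{n\times n},\hat{\mathbf z}_n)-\mathrm{pen}(k,n)\right\}$$ and $$\hat k_{\mathrm{NMCL}}(\mathbf{A}_{n\times n})=\arg\max_{1\le k\le n}\left\{\log \mathrm{NMCL}_k(\mathbf{A}_{n\times n},\hat{\mathbf z}_n)-\mathrm{pen}(k,n)\right\}$$ satisfy $\hat k_{\mathrm{DNML}}(\mathbf{A}_{n\times n})=k_0$ and $\hat k_{\mathrm{NMCL}}(\mathbf{A}_{n\times n})=k_0$ eventually almost surely as $n\to\infty$. Here, for each $k$, $\hat{\mathbf z}_n\in[k]^n$ is the maximum complete likelihood label assignment with $k$ communities computed from $\mathbf A_{n\times n}$ (defined in the context).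
   Context: **Networks.** A network on $n$ nodes is an undirected simple graph, identified with its symmetric adjacency matrix $\mathbf a_{n\times n}=(a_{ij})\in\{0,1\}^{n\times n}$ with zero diagonal; sums $\sum_{\mathbf x_{n\times n}}$ run over all networks on $n$ nodes. $[k]=\{1,\dots,k\}$; sums $\sum_{\mathbf e_n}$ run over $[k]^n$. **Parameter spaces.** $\mathcal P^k=\{P\in[0,1]^{k\times k}: P\text{ symmetric}\}$, $\Pi^k=\{\pi\in(0,1]^k:\sum_{a=1}^k\pi_a=1\}$. **Stochastic block model (SBM)** with $k$ communities and parameters $\pi\in\Pi^k$, $P\in\mathcal P^k$: the labels $\mathbf Z_n=(Z_1,\dots,Z_n)$ are i.i.d. with $\mathbb P(Z_i=a)=\pi_a$, $a\in[k]$; conditionally on $\mathbf Z_n$ the variables $A_{ij}$, $1\le i<j\le n$, are independent and $A_{ij}$ given $Z_i=a,Z_j=b$ is Bernoulli$(P_{ab})$. **Likelihoods.** For $\mathbf z_n\in[k]^n$ let $n_a(\mathbf z_n)=\sum_{i=1}^n \mathbf 1\{z_i=a\}$; for $a\ne b$ let $o_{ab}(\mathbf a_{n\times n},\mathbf z_n)=\sum_{i,j=1}^n a_{ij}\mathbf 1\{z_i=a,z_j=b\}$ and $n_{ab}(\mathbf z_n)=n_a(\mathbf z_n)n_b(\mathbf z_n)$; let $o_{aa}(\mathbf a_{n\times n},\mathbf z_n)=\sum_{i<j}a_{ij}\mathbf 1\{z_i=a,z_j=a\}$ and $n_{aa}(\mathbf z_n)=\tfrac12 n_a(\mathbf z_n)(n_a(\mathbf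 z_n)-1)$. Put (with $0^0=1$) $$\mathbb P_P(\mathbf a_{n\times n}\mid\mathbf z_n)=\prod_{1\le a\le b\le k}P_{ab}^{o_{ab}}(1-P_{ab})^{n_{ab}-o_{ab}},\quad \mathbb P_\pi(\mathbf z_n)=\prod_{a=1}^k\pi_a^{n_a(\mathbf z_n)},$$ $$\mathbb P_{\pi,P}(\mathbf a_{n\times n},\mathbf z_n)=\mathbb P_P(\mathbf a_{n\times n}\mid\mathbf z_n)\,\mathbb P_\pi(\mathbf z_n).$$ **Normalized Maximum Complete Likelihood.** $$\mathrm{NMCL}_k(\mathbf a_{n\times n},\mathbf z_n)=\frac{\sup_{\pi\in\Pi^k,P\in\mathcal P^k}\mathbb P_{\pi,P}(\mathbf a_{n\times n},\mathbf z_n)}{\sum_{\mathbf e_n}\sum_{\mathbf x_{n\times n}}\sup_{\pi\in\Pi^k,P\in\mathcal P^k}\mathbb P_{\pi,P}(\mathbf x_{n\times n},\mathbf e_n)}.$$ **Decomposed Normalized Maximum Likelihood.** $$\mathrm{DNML}_k(\mathbf a_{n\times n},\mathbf z_n)=\frac{\sup_{P\in\mathcal P^k}\mathbb P_P(\mathbf a_{n\times n}\mid\mathbf z_n)}{\sum_{\mathbf x_{n\times n}}\sup_{P\in\mathcal P^k}\mathbb P_P(\mathbf x_{n\times n}\mid\mathbf z_n)}\cdot\frac{\sup_{\pi\in\Pi^k}\mathbb P_\pi(\mathbf z_n)}{\sum_{\mathbf e_n}\sup_{\pi\in\Pi^k}\mathbb P_\pi(\mathbf e_n)}.$$ **Estimated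 labels.** For a network $\mathbf a_{n\times n}$ and a number of communities $k$, $\hat{\mathbf z}_n=\arg\max_{\mathbf z_n\in[k]^n}\{\sup_{\pi\in\Pi^k,P\in\mathcal P^k}\mathbb P_{\pi,P}(\mathbf a_{n\times n},\mathbf z_n)\}$; it depends on $\mathbf a_{n\times n}$ and on $k$. **Conventions.** $\pi_0$ is fixed; $\rho_n>0$. The networks for different $n$ live on a common probability space. "Eventually almost surely as $n\to\infty$" means: with probability one there is a (random) $N$ such that the property holds for all $n\ge N$. *)

theory Defs
  imports "HOL-Probability.Probability"
begin

text \<open>Vectors and matrices of variable size are functions on natural numbers indexed from 1.
  Networks and labelings vanish (respectively are \<^const>\<open>undefined\<close>) outside their index range, so
  that each of them is represented by exactly one function and sums over all of them make sense.
  For parameters only the entries with index in \<open>{1..k}\<close> are constrained or used.\<close>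

definition networks :: "nat \<Rightarrow> (nat \<Rightarrow> nat \<Rightarrow> nat) set" where
  "networks n = {a. (\<forall>i j. a i j \<in> {0, 1}) \<and> (\<forall>i j. a i j = a j i) \<and> (\<forall>i. a i i = 0) \<and>
                    (\<forall>i j. \<not> (i \<in> {1..n} \<and> j \<in> {1..n}) \<longrightarrow> a i j = 0)}"

definition labelings :: "nat \<Rightarrow> nat \<Rightarrow> (nat \<Rightarrow> nat) set" where
  "labelings n k = {1..n} \<rightarrow>\<^sub>E {1..k}"

definition edge_params :: "nat \<Rightarrow> (nat \<Rightarrow> nat \<Rightarrow> real) set" where
  "edge_params k = {P. \<forall>a\<in>{1..k}. \<forall>b\<in>{1..k}. 0 \<le> P a b \<and> P a b \<le> 1 \<and> P a b = P b a}"

definition label_params :: "nat \<Rightarrow> (nat \<Rightarrow> real) set" where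
  "label_params k = {p. (\<forall>a\<in>{1..k}. 0 < p a \<and> p a \<le> 1) \<and> (\<Sum>a=1..k. p a) = 1}"


subsection \<open>The stochastic block model\<close>

definition label_pmf :: "nat \<Rightarrow> (nat \<Rightarrow> real) \<Rightarrow> nat pmf" where
  "label_pmf k p = embed_pmf (\<lambda>a. if a \<in> {1..k} then p a else 0)"

text \<open>Joint law of labels and network: \<^const>\<open>Pi_pmf\<close> is the law of a finite family of independent
  variables, its second argument being the default value outside the index set.\<close>

definition sbm_pmf ::
  "nat \<Rightarrow> nat \<Rightarrow> (nat \<Rightarrow> real) \<Rightarrow> (nat \<Rightarrow> nat \<Rightarrow> real) \<Rightarrow> ((nat \<Rightarrow> nat) \<times> (nat \<Rightarrow> nat \<Rightarrow> nat)) pmf" where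
  "sbm_pmf n k p P =
     bind_pmf (Pi_pmf {1..n} undefined (\<lambda>_. label_pmf k p)) (\<lambda>z.
     bind_pmf (Pi_pmf {(i, j). 1 \<le> i \<and> i < j \<and> j \<le> n} False
                (\<lambda>(i, j). bernoulli_pmf (P (z i) (z j)))) (\<lambda>e.
     return_pmf (z, \<lambda>i j. of_bool (e (i, j) \<or> e (j, i)))))"

text \<open>The labels are latent: only the network is observed, so only its law is prescribed.\<close>

definition sbm_network ::
  "'w measure \<Rightarrow> nat \<Rightarrow> nat \<Rightarrow> (nat \<Rightarrow> real) \<Rightarrow> (nat \<Rightarrow> nat \<Rightarrow> real) \<Rightarrow>
   ('w \<Rightarrow> nat \<Rightarrow> nat \<Rightarrow> nat) \<Rightarrow> bool" where
  "sbm_network M n k p P A \<longleftrightarrow>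
     A \<in> M \<rightarrow>\<^sub>M count_space (networks n) \<and>
     (\<forall>x\<in>networks n. \<P>(w in M. A w = x) = pmf (map_pmf snd (sbm_pmf n k p P)) x)"


subsection \<open>Likelihoods\<close>

definition n_lab :: "nat \<Rightarrow> (nat \<Rightarrow> nat) \<Rightarrow> nat \<Rightarrow> nat" where
  "n_lab n z a = (\<Sum>i=1..n. of_bool (z i = a))"

definition n_pair :: "nat \<Rightarrow> (nat \<Rightarrow> nat) \<Rightarrow> nat \<Rightarrow> nat \<Rightarrow> nat" where
  "n_pair n z a b =
     (if a = b then n_lab n z a * (n_lab n z a - 1) div 2 else n_lab n z a * n_lab n z b)"

definition o_pair :: "nat \<Rightarrow> (nat \<Rightarrow> nat \<Rightarrow> nat) \<Rightarrow> (nat \<Rightarrow> nat) \<Rightarrow> nat \<Rightarrow> nat \<Rightarrow> nat" where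
  "o_pair n x z a b =
     (if a = b then (\<Sum>i=1..n. \<Sum>j=i+1..n. x i j * of_bool (z i = a \<and> z j = a))
      else (\<Sum>i=1..n. \<Sum>j=1..n. x i j * of_bool (z i = a \<and> z j = b)))"

text \<open>The truncated subtraction is harmless: \<open>o_pair n x z a b \<le> n_pair n z a b\<close> for networks \<open>x\<close>.\<close>

definition cond_lik ::
  "nat \<Rightarrow> nat \<Rightarrow> (nat \<Rightarrow> nat \<Rightarrow> real) \<Rightarrow> (nat \<Rightarrow> nat \<Rightarrow> nat) \<Rightarrow> (nat \<Rightarrow> nat) \<Rightarrow> real" where
  "cond_lik n k P x z =
     (\<Prod>a=1..k. \<Prod>b=a..k.
        P a b ^ o_pair n x z a b * (1 - P a b) ^ (n_pair n z a b - o_pair n x z a b))"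

definition label_lik :: "nat \<Rightarrow> nat \<Rightarrow> (nat \<Rightarrow> real) \<Rightarrow> (nat \<Rightarrow> nat) \<Rightarrow> real" where
  "label_lik n k p z = (\<Prod>a=1..k. p a ^ n_lab n z a)"

definition complete_lik ::
  "nat \<Rightarrow> nat \<Rightarrow> (nat \<Rightarrow> real) \<Rightarrow> (nat \<Rightarrow> nat \<Rightarrow> real) \<Rightarrow> (nat \<Rightarrow> nat \<Rightarrow> nat) \<Rightarrow> (nat \<Rightarrow> nat) \<Rightarrow> real" where
  "complete_lik n k p P x z = cond_lik n k P x z * label_lik n k p z"

definition max_complete_lik ::
  "nat \<Rightarrow> nat \<Rightarrow> (nat \<Rightarrow> nat \<Rightarrow> nat) \<Rightarrow> (nat \<Rightarrow> nat) \<Rightarrow> real" where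
  "max_complete_lik n k x z =
     (SUP (p, P) \<in> label_params k \<times> edge_params k. complete_lik n k p P x z)"

definition max_cond_lik :: "nat \<Rightarrow> nat \<Rightarrow> (nat \<Rightarrow> nat \<Rightarrow> nat) \<Rightarrow> (nat \<Rightarrow> nat) \<Rightarrow> real" where
  "max_cond_lik n k x z = (SUP P \<in> edge_params k. cond_lik n k P x z)"

definition max_label_lik :: "nat \<Rightarrow> nat \<Rightarrow> (nat \<Rightarrow> nat) \<Rightarrow> real" where
  "max_label_lik n k z = (SUP p \<in> label_params k. label_lik n k p z)"

definition NMCL :: "nat \<Rightarrow> nat \<Rightarrow> (nat \<Rightarrow> nat \<Rightarrow> nat) \<Rightarrow> (nat \<Rightarrow> nat) \<Rightarrow> real" where
  "NMCL n k x z =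
     max_complete_lik n k x z /
     (\<Sum>e\<in>labelings n k. \<Sum>y\<in>networks n. max_complete_lik n k y e)"

definition DNML :: "nat \<Rightarrow> nat \<Rightarrow> (nat \<Rightarrow> nat \<Rightarrow> nat) \<Rightarrow> (nat \<Rightarrow> nat) \<Rightarrow> real" where
  "DNML n k x z =
     max_cond_lik n k x z / (\<Sum>y\<in>networks n. max_cond_lik n k y z) *
     (max_label_lik n k z / (\<Sum>e\<in>labelings n k. max_label_lik n k e))"

definition pen :: "real \<Rightarrow> nat \<Rightarrow> nat \<Rightarrow> real" where
  "pen \<epsilon> k n =
     (\<Sum>i=1..k-1. (real i * (real i + 2) + 1 + \<epsilon>) / 2 * ln (real n)) +
     real n * (\<Sum>i=1..k-1. ln (real i))"

text \<open>Maximisers need not be unique, so an arg max is any selection of a maximiser.\<close>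

definition max_label_estimator ::
  "(nat \<Rightarrow> nat \<Rightarrow> (nat \<Rightarrow> nat \<Rightarrow> nat) \<Rightarrow> nat \<Rightarrow> nat) \<Rightarrow> bool" where
  "max_label_estimator zhat \<longleftrightarrow>
     (\<forall>n\<ge>1. \<forall>k\<ge>1. \<forall>x\<in>networks n.
        is_arg_max (max_complete_lik n k x) (\<lambda>z. z \<in> labelings n k) (zhat n k x))"

end

theory Submission
  imports Defs
begin

text \<open>Write \<open>L\<^sub>k(x)\<close> for the complete likelihood at \<open>k\<close> classes, maximised over labels and parameters.

  Normalisers: for a fixed parameter the likelihood is a probability in the data, and up to a constant
  factor every maximum likelihood is attained on a finite parameter grid with \<open>O(\<surd>m)\<close> points per
  Bernoulli parameter with \<open>m\<close> observations. Hence the normalisers of both criteria lie between \<open>1\<close>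
  and \<open>O(n powr (k (k + 1) / 2 + (k - 1) / 2))\<close>.

  Overestimation: the law of the network is at most \<open>k0\<^sup>n L\<^sub>k\<^sub>0(x)\<close>. If \<open>k > k0\<close> is selected, this is at
  most \<open>k0\<^sup>n\<close> times the normaliser, times \<open>exp (pen k0 n - pen k n)\<close>, times the criterion at \<open>k\<close>, and
  the latter sums to at most \<open>1\<close> over all networks. The penalty makes this \<open>O(n powr (-1 - \<epsilon>/2))\<close>,
  which is summable.

  Underestimation: if \<open>k < k0\<close> is selected, the true conditional likelihood is at most \<open>exp (O(n))\<close>
  times a \<open>k\<close>-class likelihood on the grid. A union bound over labels and grid points reduces the
  probability of this to Bhattacharyya coefficients of product measures. By the pigeonhole principle
  two true classes share a frequent label, so these coefficients are \<open>exp (- c n\<^sup>2 \<rho>\<^sub>n)\<close>, which beats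
  \<open>exp (O(n))\<close> because \<open>n \<rho>\<^sub>n \<rightarrow> \<infinity>\<close>.\<close>

subsection \<open>Edge products\<close>

text \<open>The candidates \<open>k\<close> range up to \<open>n\<close>, so no constant depending
  on \<open>k\<close> may enter the overestimation bound. Hence only the normaliser at
  \<open>k0\<close> is estimated, while at the selected \<open>k\<close> the total mass of the score
  suffices. The step of \<open>pen\<close> from \<open>k0\<close> to \<open>k0 + 1\<close> fits this
  exactly: \<open>n * ln k0\<close> cancels the number \<open>k0 ^ n\<close> of latent labelings,
  and the coefficient of \<open>ln n\<close> exceeds the normaliser exponent
  \<open>(k0 * (k0 + 2) - 1) / 2\<close> by \<open>1 + \<epsilon> / 2\<close>. With so little slack
  a parameter may cost only about the square root of its sample size. A uniform grid of that size
  fails near 0 and 1, where the variance is small; this forces the quadratic spacing. For too few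
  classes the bounds can be crude, but \<open>\<rho> n\<close> may tend to zero and the fitted
  labels and parameters depend on the network. Bhattacharyya coefficients suit both difficulties:
  they factorise over edges, need no bound on log-likelihood ratios, and see the parameters through
  square roots, so that the separation of classes scales exactly with
  \<open>\<rho> n\<close>.\<close>

definition edges :: "nat \<Rightarrow> (nat \<times> nat) set" where
  "edges n = {(i, j). 1 \<le> i \<and> i < j \<and> j \<le> n}"

lemma finite_edges [simp]: "finite (edges n)"
  by (rule finite_subset[of _ "{1..n} \<times> {1..n}"]) (auto simp: edges_def)

lemma edges_eq_Sigma: "edges n = Sigma {1..n} (\<lambda>i. {i+1..n})"
  by (auto simp: edges_def)

lemma sum_edges: "(\<Sum>i=1..n. \<Sum>j=i+1..n. f i j) = (\<Sum>(i, j)\<in>edges n. f i j)"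
  by (simp add: edges_eq_Sigma sum.Sigma)

lemma sum_pairs_eq_sum_edges:
  fixes f :: "nat \<Rightarrow> nat \<Rightarrow> 'a :: comm_monoid_add"
  assumes diag: "\<And>i. f i i = 0"
  shows "(\<Sum>i=1..n. \<Sum>j=1..n. f i j) = (\<Sum>(i, j)\<in>edges n. f i j + f j i)"
proof -
  have "(\<Sum>i=1..n. \<Sum>j=1..n. f i j) = (\<Sum>(i, j)\<in>{1..n} \<times> {1..n}. f i j)"
    by (simp add: sum.cartesian_product)
  also have "\<dots> = (\<Sum>(i, j)\<in>edges n \<union> prod.swap ` edges n. f i j)"
  proof (rule sum.mono_neutral_right)
    show "\<forall>x\<in>{1..n} \<times> {1..n} - (edges n \<union> prod.swap ` edges n). (case x of (i, j) \<Rightarrow> f i j) = 0"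
    proof
      fix e assume e: "e \<in> {1..n} \<times> {1..n} - (edges n \<union> prod.swap ` edges n)"
      obtain i j where ij: "e = (i, j)" by (cases e)
      have *: "i \<in> {1..n}" "j \<in> {1..n}" "(i, j) \<notin> edges n \<union> prod.swap ` edges n"
        using e ij by auto
      have "(j, i) \<notin> edges n"
        using *(3) by (metis UnI2 image_eqI swap_simp)
      then have "i = j"
        using * by (auto simp: edges_def)
      then show "(case e of (i, j) \<Rightarrow> f i j) = 0" by (simp add: diag ij)
    qed
  qed (auto simp: edges_def)
  also have "\<dots> = (\<Sum>(i, j)\<in>edges n. f i j) + (\<Sum>(i, j)\<in>prod.swap ` edges n. f i j)"
  proof (rule sum.union_disjoint)
    show "edges n \<inter> prod.swap ` edges n = {}" by (auto simp: edges_def)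
  qed simp_all
  also have "(\<Sum>(i, j)\<in>prod.swap ` edges n. f i j) = (\<Sum>(i, j)\<in>edges n. f j i)"
    by (subst sum.reindex) (auto simp: o_def case_prod_beta)
  finally show ?thesis
    by (simp add: sum.distrib case_prod_beta)
qed

text \<open>The unordered pair of labels of an edge, stored sorted because \<open>cond_lik\<close>
  multiplies over \<open>a \<le> b\<close> only.\<close>

definition pair_class :: "(nat \<Rightarrow> nat) \<Rightarrow> nat \<times> nat \<Rightarrow> nat \<times> nat" where
  "pair_class z e = (min (z (fst e)) (z (snd e)), max (z (fst e)) (z (snd e)))"

definition class_pairs :: "nat \<Rightarrow> (nat \<times> nat) set" where
  "class_pairs k = Sigma {1..k} (\<lambda>a. {a..k})"

lemma finite_class_pairs [simp]: "finite (class_pairs k)"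
  by (simp add: class_pairs_def)

lemma card_class_pairs: "2 * card (class_pairs k) = k * (k + 1)"
proof -
  have "card (class_pairs k) = (\<Sum>a=1..k. Suc k - a)"
    by (simp add: class_pairs_def)
  also have "\<dots> = (\<Sum>i=1..k. i)"
    by (rule sum.reindex_bij_witness[of _ "\<lambda>i. Suc k - i" "\<lambda>i. Suc k - i"]) auto
  finally show ?thesis
    using gauss_sum_from_Suc_0[of k, where 'a = nat] by simp
qed

lemma o_pair_eq_sum_edges:
  assumes sym: "\<And>i j. x i j = x j i" and diag: "\<And>i. x i i = 0" and "a \<le> b"
  shows "o_pair n x z a b = (\<Sum>e\<in>{e\<in>edges n. pair_class z e = (a, b)}. x (fst e) (snd e))"
proof -
  have R: "(\<Sum>e\<in>{e\<in>edges n. pair_class z e = (a, b)}. x (fst e) (snd e)) =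
      (\<Sum>e\<in>edges n. if pair_class z e = (a, b) then x (fst e) (snd e) else 0)"
    by (simp add: sum.inter_filter)
  show ?thesis
  proof (cases "a = b")
    case True
    have "o_pair n x z a b = (\<Sum>(i, j)\<in>edges n. x i j * of_bool (z i = a \<and> z j = a))"
      using True by (subst sum_edges[symmetric]) (simp add: o_pair_def)
    also have "\<dots> = (\<Sum>e\<in>edges n. if pair_class z e = (a, b) then x (fst e) (snd e) else 0)"
      using True by (intro sum.cong) (auto simp: pair_class_def min_def max_def split: if_splits)
    finally show ?thesis using R by simp
  next
    case False
    then have "o_pair n x z a b = (\<Sum>i=1..n. \<Sum>j=1..n. x i j * of_bool (z i = a \<and> z j = b))"
      by (simp add: o_pair_def)
    also have "\<dots> = (\<Sum>(i, j)\<in>edges n. x i j * of_bool (z i = a \<and> z j = b)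
        + x j i * of_bool (z j = a \<and> z i = b))"
      by (rule sum_pairs_eq_sum_edges) (simp add: diag)
    also have "\<dots> = (\<Sum>e\<in>edges n. if pair_class z e = (a, b) then x (fst e) (snd e) else 0)"
      using False \<open>a \<le> b\<close>
      by (intro sum.cong) (auto simp: pair_class_def min_def max_def sym split: if_splits)
    finally show ?thesis using R by simp
  qed
qed

text \<open>Reading the number of pairs as an edge count of the complete graph lets
  \<open>o_pair_eq_sum_edges\<close> serve both exponents of \<open>cond_lik\<close>. On the
  diagonal the sum over ordered pairs is evaluated twice: as double the edge count and as
  \<open>m * (m - 1)\<close>.\<close>

lemma n_pair_eq_o_pair: "n_pair n z a b = o_pair n (\<lambda>i j. of_bool (i \<noteq> j)) z a b"
proof (cases "a = b")
  case True
  define f where "f = (\<lambda>i j. of_bool (i \<noteq> j) * of_bool (z i = a \<and> z j = a) :: nat)"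
  have "(\<Sum>i=1..n. \<Sum>j=1..n. f i j) = 2 * o_pair n (\<lambda>i j. of_bool (i \<noteq> j)) z a b"
  proof -
    have "(\<Sum>i=1..n. \<Sum>j=1..n. f i j) = (\<Sum>(i, j)\<in>edges n. f i j + f j i)"
      by (rule sum_pairs_eq_sum_edges) (simp add: f_def)
    also have "\<dots> = (\<Sum>(i, j)\<in>edges n. 2 * f i j)"
      by (intro sum.cong) (auto simp: f_def)
    also have "\<dots> = 2 * o_pair n (\<lambda>i j. of_bool (i \<noteq> j)) z a b"
    proof -
      have "(\<Sum>(i, j)\<in>edges n. f i j) = o_pair n (\<lambda>i j. of_bool (i \<noteq> j)) z a b"
        using True by (subst sum_edges[symmetric]) (simp add: o_pair_def f_def)
      then show ?thesis by (simp add: sum_distrib_left[symmetric] case_prod_beta)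
    qed
    finally show ?thesis .
  qed
  moreover have "(\<Sum>i=1..n. \<Sum>j=1..n. f i j) = n_lab n z a * (n_lab n z a - 1)"
  proof -
    have "(\<Sum>j=1..n. f i j) = of_bool (z i = a) * (n_lab n z a - 1)" if "i \<in> {1..n}" for i
    proof (cases "z i = a")
      case True
      have "n_lab n z a = of_bool (z i = a) + (\<Sum>j\<in>{1..n}-{i}. of_bool (z j = a))"
        unfolding n_lab_def using that by (intro sum.remove) auto
      moreover have "(\<Sum>j=1..n. f i j) = f i i + (\<Sum>j\<in>{1..n}-{i}. f i j)"
        using that by (intro sum.remove) auto
      moreover have "(\<Sum>j\<in>{1..n}-{i}. f i j) = (\<Sum>j\<in>{1..n}-{i}. of_bool (z j = a))"
        using True by (intro sum.cong) (auto simp: f_def)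
      ultimately show ?thesis using True by (simp add: f_def)
    qed (simp add: f_def)
    then have "(\<Sum>i=1..n. \<Sum>j=1..n. f i j) = (\<Sum>i=1..n. of_bool (z i = a) * (n_lab n z a - 1))"
      by (intro sum.cong) auto
    then show ?thesis by (simp only: sum_distrib_right[symmetric] n_lab_def)
  qed
  ultimately show ?thesis
    using True by (simp add: n_pair_def)
next
  case False
  have "n_lab n z a * n_lab n z b = (\<Sum>i=1..n. \<Sum>j=1..n. of_bool (z i = a) * of_bool (z j = b))"
    by (simp only: n_lab_def sum_product)
  also have "\<dots> = (\<Sum>i=1..n. \<Sum>j=1..n. of_bool (i \<noteq> j) * of_bool (z i = a \<and> z j = b))"
    using False by (intro sum.cong) auto
  finally show ?thesis using False by (simp add: n_pair_def o_pair_def)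
qed

lemma n_pair_eq_card:
  assumes "a \<le> b"
  shows "n_pair n z a b = card {e\<in>edges n. pair_class z e = (a, b)}"
proof -
  have "n_pair n z a b = (\<Sum>e\<in>{e\<in>edges n. pair_class z e = (a, b)}. of_bool (fst e \<noteq> snd e))"
    unfolding n_pair_eq_o_pair by (rule o_pair_eq_sum_edges) (use assms in auto)
  also have "\<dots> = (\<Sum>e\<in>{e\<in>edges n. pair_class z e = (a, b)}. 1)"
    by (intro sum.cong) (auto simp: edges_def)
  finally show ?thesis by simp
qed

lemma n_pair_le:
  assumes "a \<le> b" shows "n_pair n z a b \<le> n * n"
proof -
  have "n_pair n z a b \<le> card ({1..n} \<times> {1..n})"
    unfolding n_pair_eq_card[OF assms] by (rule card_mono) (auto simp: edges_def)
  then show ?thesis by simp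
qed

section \<open>Conditional likelihoods as products of Bernoulli weights\<close>

definition bern_w :: "real \<Rightarrow> nat \<Rightarrow> real" where
  "bern_w p y = p ^ y * (1 - p) ^ (1 - y)"

lemma networks_le_1: "x \<in> networks n \<Longrightarrow> x i j \<le> 1"
  by (auto simp: networks_def) (metis One_nat_def bot_nat_0.extremum order_refl)

lemma networks_sym: "x \<in> networks n \<Longrightarrow> x i j = x j i"
  by (auto simp: networks_def)

lemma networks_diag: "x \<in> networks n \<Longrightarrow> x i i = 0"
  by (auto simp: networks_def)

lemma o_pair_le_n_pair:
  assumes "x \<in> networks n" "a \<le> b"
  shows "o_pair n x z a b \<le> n_pair n z a b"
proof -
  have "o_pair n x z a b = (\<Sum>e\<in>{e\<in>edges n. pair_class z e = (a, b)}. x (fst e) (snd e))"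
    by (rule o_pair_eq_sum_edges) (use assms networks_sym networks_diag in auto)
  also have "\<dots> \<le> (\<Sum>e\<in>{e\<in>edges n. pair_class z e = (a, b)}. 1)"
    by (intro sum_mono networks_le_1[OF assms(1)])
  finally show ?thesis using assms(2) by (simp add: n_pair_eq_card)
qed

lemma edge_paramsD:
  assumes "P \<in> edge_params k" "a \<in> {1..k}" "b \<in> {1..k}"
  shows "0 \<le> P a b" "P a b \<le> 1" "P a b = P b a"
  using assms by (auto simp: edge_params_def)

lemma labelingsD: "z \<in> labelings n k \<Longrightarrow> i \<in> {1..n} \<Longrightarrow> z i \<in> {1..k}"
  by (auto simp: labelings_def)

lemma edgesD: "e \<in> edges n \<Longrightarrow> fst e \<in> {1..n}" "e \<in> edges n \<Longrightarrow> snd e \<in> {1..n}"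
  by (auto simp: edges_def)

text \<open>Grouping the edges by \<open>pair_class\<close> dissolves the block exponents into one
  weight per edge; symmetry of \<open>P\<close> makes the weight depend on the sorted pair alone.
  Sums over networks factorise through this form.\<close>

lemma cond_lik_eq_prod_edges:
  assumes x: "x \<in> networks n" and z: "z \<in> labelings n k" and P: "P \<in> edge_params k"
  shows "cond_lik n k P x z =
    (\<Prod>e\<in>edges n. bern_w (P (z (fst e)) (z (snd e))) (x (fst e) (snd e)))"
proof -
  let ?f = "\<lambda>e. bern_w (P (z (fst e)) (z (snd e))) (x (fst e) (snd e))"
  have sub: "pair_class z ` edges n \<subseteq> class_pairs k"
  proof
    fix c assume "c \<in> pair_class z ` edges n"
    then obtain e where e: "e \<in> edges n" "c = pair_class z e" by auto
    then show "c \<in> class_pairs k"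
      using labelingsD[OF z edgesD(1)[OF e(1)]] labelingsD[OF z edgesD(2)[OF e(1)]]
      by (auto simp: pair_class_def class_pairs_def)
  qed
  have "(\<Prod>e\<in>edges n. ?f e) =
      (\<Prod>c\<in>class_pairs k. \<Prod>e\<in>{e\<in>edges n. pair_class z e = c}. ?f e)"
    by (rule prod.group[symmetric]) (use sub in auto)
  also have "\<dots> = (\<Prod>(a, b)\<in>class_pairs k.
        P a b ^ o_pair n x z a b * (1 - P a b) ^ (n_pair n z a b - o_pair n x z a b))"
  proof (rule prod.cong, goal_cases)
    case (2 c)
    obtain a b where c: "c = (a, b)" by (cases c)
    then have ab: "a \<le> b" "a \<in> {1..k}" "b \<in> {1..k}" using 2 by (auto simp: class_pairs_def)
    let ?E = "{e\<in>edges n. pair_class z e = (a, b)}"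
    have o: "o_pair n x z a b = (\<Sum>e\<in>?E. x (fst e) (snd e))"
      by (rule o_pair_eq_sum_edges) (use x ab networks_sym networks_diag in auto)
    have "(\<Sum>e\<in>?E. 1 - x (fst e) (snd e)) = (\<Sum>e\<in>?E. 1) - (\<Sum>e\<in>?E. x (fst e) (snd e))"
      by (rule sum_subtractf_nat) (use networks_le_1[OF x] in auto)
    then have no: "n_pair n z a b - o_pair n x z a b = (\<Sum>e\<in>?E. 1 - x (fst e) (snd e))"
      using ab by (simp add: o n_pair_eq_card)
    have "(\<Prod>e\<in>?E. ?f e) = (\<Prod>e\<in>?E. bern_w (P a b) (x (fst e) (snd e)))"
    proof (rule prod.cong, goal_cases)
      case (2 e)
      then have "P (z (fst e)) (z (snd e)) = P a b"
        using edge_paramsD(3)[OF P ab(2,3)]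
        by (auto simp: pair_class_def min_def max_def split: if_splits)
      then show ?case by simp
    qed simp
    also have "\<dots> = P a b ^ o_pair n x z a b * (1 - P a b) ^ (n_pair n z a b - o_pair n x z a b)"
      unfolding no unfolding o by (simp add: bern_w_def prod.distrib power_sum)
    finally show ?case by (simp add: c)
  qed simp
  also have "\<dots> = cond_lik n k P x z"
    by (simp add: cond_lik_def class_pairs_def prod.Sigma)
  finally show ?thesis by simp
qed

text \<open>A network is a free choice of one bit per edge. This encoding carries sums over networks
  to sums over a \<open>PiE\<close> set, where sum and product can be exchanged.\<close>

definition net_of :: "nat \<Rightarrow> (nat \<times> nat \<Rightarrow> nat) \<Rightarrow> nat \<Rightarrow> nat \<Rightarrow> nat" where
  "net_of n g i j = (if (i, j) \<in> edges n then g (i, j) else if (j, i) \<in> edges n then g (j, i) else 0)"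

lemma bij_betw_net_of: "bij_betw (net_of n) (edges n \<rightarrow>\<^sub>E {0, 1}) (networks n)"
proof (rule bij_betw_byWitness[where f' = "\<lambda>x. restrict (\<lambda>e. x (fst e) (snd e)) (edges n)"])
  show "\<forall>g\<in>edges n \<rightarrow>\<^sub>E {0, 1}. restrict (\<lambda>e. net_of n g (fst e) (snd e)) (edges n) = g"
  proof
    fix g assume g: "g \<in> edges n \<rightarrow>\<^sub>E {0, 1 :: nat}"
    then show "restrict (\<lambda>e. net_of n g (fst e) (snd e)) (edges n) = g"
      by (intro ext) (auto simp: net_of_def restrict_def PiE_arb[OF g])
  qed
  show "\<forall>x\<in>networks n. net_of n (restrict (\<lambda>e. x (fst e) (snd e)) (edges n)) = x"
  proof
    fix x assume x: "x \<in> networks n"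
    have "x i j = 0" if "(i, j) \<notin> edges n" "(j, i) \<notin> edges n" for i j
    proof (cases "i \<in> {1..n} \<and> j \<in> {1..n}")
      case True
      then have "i = j" using that by (auto simp: edges_def)
      then show ?thesis using networks_diag[OF x] by simp
    qed (use x in \<open>simp add: networks_def\<close>)
    then show "net_of n (restrict (\<lambda>e. x (fst e) (snd e)) (edges n)) = x"
      using networks_sym[OF x] by (intro ext) (simp add: net_of_def)
  qed
  have "net_of n g \<in> networks n" if g: "g \<in> edges n \<rightarrow>\<^sub>E {0, 1}" for g
  proof -
    have "g e = 0 \<or> g e = 1" if "e \<in> edges n" for e
      using PiE_mem[OF g that] by auto
    moreover have "\<not> ((i, j) \<in> edges n \<and> (j, i) \<in> edges n)" "(i, i) \<notin> edges n" for i j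
      by (auto simp: edges_def)
    moreover have "(i, j) \<notin> edges n" "(j, i) \<notin> edges n"
      if "\<not> (i \<in> {1..n} \<and> j \<in> {1..n})" for i j
      using that by (auto simp: edges_def)
    ultimately show ?thesis
      unfolding networks_def net_of_def by auto
  qed
  then show "net_of n ` (edges n \<rightarrow>\<^sub>E {0, 1}) \<subseteq> networks n" by blast
  show "(\<lambda>x. restrict (\<lambda>e. x (fst e) (snd e)) (edges n)) ` networks n \<subseteq> edges n \<rightarrow>\<^sub>E {0, 1}"
    by (auto simp: networks_def) (metis bot_nat_0.not_eq_extremum)
qed

lemma finite_networks [simp]: "finite (networks n)"
  using bij_betw_finite[OF bij_betw_net_of] by (simp add: finite_PiE)

lemma finite_labelings [simp]: "finite (labelings n k)"
  by (simp add: labelings_def finite_PiE)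

lemma sum_networks_prod_edges:
  fixes f :: "nat \<times> nat \<Rightarrow> nat \<Rightarrow> real"
  shows "(\<Sum>x\<in>networks n. \<Prod>e\<in>edges n. f e (x (fst e) (snd e))) = (\<Prod>e\<in>edges n. f e 0 + f e 1)"
proof -
  have "(\<Sum>x\<in>networks n. \<Prod>e\<in>edges n. f e (x (fst e) (snd e))) =
      (\<Sum>g\<in>edges n \<rightarrow>\<^sub>E {0, 1}. \<Prod>e\<in>edges n. f e (net_of n g (fst e) (snd e)))"
    by (rule sum.reindex_bij_betw[OF bij_betw_net_of, symmetric])
  also have "\<dots> = (\<Sum>g\<in>edges n \<rightarrow>\<^sub>E {0, 1}. \<Prod>e\<in>edges n. f e (g e))"
    by (intro sum.cong prod.cong) (auto simp: net_of_def)
  also have "\<dots> = (\<Prod>e\<in>edges n. \<Sum>y\<in>{0, 1}. f e y)"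
    by (rule prod_sum_PiE[symmetric]) auto
  finally show ?thesis by simp
qed

lemma sum_networks_cond_lik:
  assumes z: "z \<in> labelings n k" and P: "P \<in> edge_params k"
  shows "(\<Sum>x\<in>networks n. cond_lik n k P x z) = 1"
proof -
  have "(\<Sum>x\<in>networks n. cond_lik n k P x z) = (\<Sum>x\<in>networks n.
      \<Prod>e\<in>edges n. bern_w (P (z (fst e)) (z (snd e))) (x (fst e) (snd e)))"
    by (intro sum.cong cond_lik_eq_prod_edges assms) auto
  also have "\<dots> = 1"
    by (subst sum_networks_prod_edges) (simp add: bern_w_def)
  finally show ?thesis .
qed

section \<open>Label likelihoods and bounds on both factors\<close>

lemma n_lab_eq_card: "n_lab n z a = card {i\<in>{1..n}. z i = a}"
proof -
  have "card {i\<in>{1..n}. z i = a} = (\<Sum>i\<in>{i\<in>{1..n}. z i = a}. 1)" by simp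
  also have "\<dots> = (\<Sum>i=1..n. if z i = a then 1 else 0)" by (rule sum.inter_filter) simp
  finally show ?thesis by (simp add: n_lab_def of_bool_def)
qed

lemma label_lik_eq_prod:
  assumes z: "z \<in> labelings n k"
  shows "label_lik n k p z = (\<Prod>i=1..n. p (z i))"
proof -
  have "(\<Prod>i=1..n. p (z i)) = (\<Prod>a=1..k. \<Prod>i\<in>{i\<in>{1..n}. z i = a}. p (z i))"
    by (rule prod.group[symmetric]) (use labelingsD[OF z] in auto)
  also have "\<dots> = (\<Prod>a=1..k. p a ^ n_lab n z a)"
  proof (rule prod.cong, goal_cases)
    case (2 a)
    have "(\<Prod>i\<in>{i\<in>{1..n}. z i = a}. p (z i)) = (\<Prod>i\<in>{i\<in>{1..n}. z i = a}. p a)"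
      by (intro prod.cong) auto
    then show ?case by (simp add: n_lab_eq_card)
  qed simp
  finally show ?thesis by (simp add: label_lik_def)
qed

lemma sum_labelings_prod:
  fixes f :: "nat \<Rightarrow> real"
  shows "(\<Sum>z\<in>labelings n k. \<Prod>i=1..n. f (z i)) = (\<Sum>a=1..k. f a) ^ n"
  using prod_sum_PiE[of "{1..n}" "\<lambda>_. {1..k}" "\<lambda>_ a. f a"] by (simp add: labelings_def)

lemma sum_labelings_label_lik:
  assumes "(\<Sum>a=1..k. p a) = 1"
  shows "(\<Sum>z\<in>labelings n k. label_lik n k p z) = 1"
  using sum_labelings_prod[of p n k] assms by (simp add: label_lik_eq_prod)

lemma card_labelings: "card (labelings n k) = k ^ n"
  by (simp add: labelings_def card_PiE)

lemma cond_lik_bounds: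
  assumes "P \<in> edge_params k"
  shows "0 \<le> cond_lik n k P x z" "cond_lik n k P x z \<le> 1"
proof -
  have "0 \<le> P a b \<and> P a b \<le> 1" if "a \<in> {1..k}" "b \<in> {a..k}" for a b
    using edge_paramsD[OF assms, of a b] that by auto
  then have *: "0 \<le> P a b ^ m * (1 - P a b) ^ l \<and> P a b ^ m * (1 - P a b) ^ l \<le> 1"
    if "a \<in> {1..k}" "b \<in> {a..k}" for a b m l
    using that by (auto intro!: mult_le_one power_le_one mult_nonneg_nonneg)
  show "0 \<le> cond_lik n k P x z" "cond_lik n k P x z \<le> 1"
    unfolding cond_lik_def by (intro prod_nonneg prod_le_1 ballI conjI; use * in blast)+
qed

lemma label_paramsD:
  assumes "p \<in> label_params k"
  shows "\<And>a. a \<in> {1..k} \<Longrightarrow> 0 < p a" "\<And>a. a \<in> {1..k} \<Longrightarrow> p a \<le> 1" "(\<Sum>a=1..k. p a) = 1"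
  using assms by (auto simp: label_params_def)

lemma label_lik_bounds:
  assumes "p \<in> label_params k"
  shows "0 < label_lik n k p z" "label_lik n k p z \<le> 1"
  unfolding label_lik_def using label_paramsD[OF assms]
  by (auto intro!: prod_pos prod_le_1 power_le_one simp: less_imp_le)


subsection \<open>Quadratic grids\<close>

text \<open>Raise \<open>t \<le> exp (t - 1)\<close> to powers, for \<open>t = p / q\<close> and
  \<open>t = (1 - p) / (1 - q)\<close>. The lemma is used in two roles. If \<open>q\<close> is the
  observed frequency \<open>j / (j + l)\<close>, the exponent vanishes, which gives the maximum
  likelihood bound. If \<open>p\<close> is that frequency, the exponent is the sample size times the
  chi-square distance \<open>(p - q)\<^sup>2 / (q * (1 - q))\<close>, which gives the grid
  bound.\<close>

lemma power_mult_power_le_exp: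
  fixes p q :: real
  assumes "0 \<le> p" "p \<le> 1" "0 < q" "q < 1"
  shows "p ^ j * (1 - p) ^ l \<le> exp (real j * (p / q - 1) + real l * ((1 - p) / (1 - q) - 1)) * (q ^ j * (1 - q) ^ l)"
proof -
  have *: "x ^ m \<le> exp (real m * (x / y - 1)) * y ^ m" if "0 \<le> x" "0 < y" for x y :: real and m
  proof -
    have "x / y \<le> exp (x / y - 1)" using exp_ge_add_one_self[of "x / y - 1"] by simp
    then have "(x / y) ^ m \<le> exp (x / y - 1) ^ m" using that by (intro power_mono) auto
    also have "\<dots> = exp (real m * (x / y - 1))" by (simp add: exp_of_nat_mult)
    finally show ?thesis using that by (simp add: power_divide pos_divide_le_eq)
  qed
  have "p ^ j * (1 - p) ^ l \<le> (exp (real j * (p / q - 1)) * q ^ j) *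
      (exp (real l * ((1 - p) / (1 - q) - 1)) * (1 - q) ^ l)"
    using assms by (intro mult_mono *) auto
  then show ?thesis by (simp add: exp_add mult_ac)
qed

lemma power_mult_power_le_max:
  fixes p s :: real
  assumes p: "0 \<le> p" "p \<le> 1" and s: "s * real m = real j" and "j \<le> m" "0 < m"
  shows "p ^ j * (1 - p) ^ (m - j) \<le> s ^ j * (1 - s) ^ (m - j)"
proof -
  have "s = real j / real m" using s \<open>0 < m\<close> by (simp add: field_simps)
  then have s01: "0 \<le> s" "s \<le> 1" using \<open>j \<le> m\<close> \<open>0 < m\<close> by auto
  consider "s = 0" | "s = 1" | "0 < s" "s < 1" using s01 by linarith
  then show ?thesis
  proof cases
    case 1
    then show ?thesis using assms by (auto intro!: power_le_one)
  next
    case 2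
    then show ?thesis using assms by (auto intro!: power_le_one)
  next
    case 3
    have l: "real (m - j) = (1 - s) * real m" using s \<open>j \<le> m\<close> by (simp add: of_nat_diff algebra_simps)
    have "real j * (p / s - 1) + real (m - j) * ((1 - p) / (1 - s) - 1) = 0"
      unfolding l s[symmetric] using 3 by (simp add: field_simps)
    then show ?thesis
      using power_mult_power_le_exp[OF p 3, of j "m - j"] by simp
  qed
qed

text \<open>The points are equally spaced in the square root, the variance-stabilising scale near 0,
  and are mirrored for the other end. The factor 1/2 stops either family at 1/2; starting at
  \<open>g = 1\<close> avoids 0 and 1, where \<open>q * (1 - q)\<close> vanishes.\<close>

definition grid :: "nat \<Rightarrow> real set" where
  "grid M = (\<lambda>g. (real g)\<^sup>2 / (2 * (real M)\<^sup>2)) ` {1..M} \<union> (\<lambda>g. 1 - (real g)\<^sup>2 / (2 * (real M)\<^sup>2)) ` {1..M}"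

lemma finite_grid [simp]: "finite (grid M)"
  by (simp add: grid_def)

lemma card_grid: "card (grid M) \<le> 2 * M"
proof -
  have "card (grid M) \<le> card {1..M} + card {1..M}"
    unfolding grid_def by (intro order.trans[OF card_Un_le] add_mono card_image_le) auto
  then show ?thesis by simp
qed

lemma grid_bounds:
  assumes "q \<in> grid M" shows "0 < q" "q < 1"
proof -
  have "0 < (real g)\<^sup>2 / (2 * (real M)\<^sup>2) \<and> (real g)\<^sup>2 / (2 * (real M)\<^sup>2) < 1" if "g \<in> {1..M}" for g
  proof -
    have "(real g)\<^sup>2 \<le> (real M)\<^sup>2" "0 < (real g)\<^sup>2" using that by (auto intro!: power_mono)
    then have "0 < (real M)\<^sup>2" "(real g)\<^sup>2 < 2 * (real M)\<^sup>2" by linarith+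
    then show ?thesis using \<open>0 < (real g)\<^sup>2\<close> by (simp add: divide_less_eq)
  qed
  then show "0 < q" "q < 1" using assms by (auto simp: grid_def)
qed

lemma grid_symmetric: "q \<in> grid M \<Longrightarrow> 1 - q \<in> grid M"
  by (auto simp: grid_def)

text \<open>Spacing the points quadratically makes the relevant distance \<open>(s - q)\<^sup>2 / (q (1 - q))\<close> to the
  nearest one uniformly \<open>O(1/M\<^sup>2)\<close>, so that only \<open>O(M)\<close> points serve all sample sizes \<open>m \<le> M\<^sup>2\<close>.\<close>

lemma grid_approx_half:
  fixes s :: real
  assumes "1 \<le> M" "0 \<le> s" "s \<le> 1 / 2"
  obtains q where "q \<in> grid M" "(real M)\<^sup>2 * (s - q)\<^sup>2 \<le> 4 * (q * (1 - q))"
proof -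
  \<comment> \<open>The real index at which the grid formula returns \<open>s\<close> exactly. It is
    rounded up, and raised to 1 when \<open>s = 0\<close>.\<close>
  define r where "r = sqrt (2 * s) * real M"
  define g where "g = max 1 (nat \<lceil>r\<rceil>)"
  define q where "q = (real g)\<^sup>2 / (2 * (real M)\<^sup>2)"
  have M: "0 < real M" using assms by simp
  have r0: "0 \<le> r" using assms by (simp add: r_def)
  have "sqrt (2 * s) \<le> 1" using assms by simp
  then have rM: "r \<le> real M" unfolding r_def using mult_right_mono[of "sqrt (2 * s)" 1 "real M"] by simp
  have "g \<in> {1..M}" using rM r0 assms(1) by (auto simp: g_def ceiling_le_iff nat_le_iff)
  then have "q \<in> grid M" by (auto simp: grid_def q_def)
  have rg: "r \<le> real g" "real g - r \<le> 1" and g1: "1 \<le> real g"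
    using r0 by (auto simp: g_def max_def nat_le_iff; linarith)+
  have rsq: "r\<^sup>2 = 2 * s * (real M)\<^sup>2" using assms by (simp add: r_def power_mult_distrib)
  then have s: "s = r\<^sup>2 / (2 * (real M)\<^sup>2)" using M by simp
  have qs: "q - s = ((real g)\<^sup>2 - r\<^sup>2) / (2 * (real M)\<^sup>2)"
    by (simp add: q_def s diff_divide_distrib)
  have "(real g)\<^sup>2 - r\<^sup>2 = (real g - r) * (real g + r)" by (simp add: power2_eq_square algebra_simps)
  also have "\<dots> \<le> 1 * (2 * real g)" using rg r0 by (intro mult_mono) auto
  finally have up: "(real g)\<^sup>2 - r\<^sup>2 \<le> 2 * real g" by simp
  have lo: "0 \<le> (real g)\<^sup>2 - r\<^sup>2" using rg r0 by simp
  have "((real g)\<^sup>2 - r\<^sup>2)\<^sup>2 \<le> (2 * real g)\<^sup>2" using up lo by (rule power_mono)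
  then have "(real M)\<^sup>2 * (q - s)\<^sup>2 \<le> (real M)\<^sup>2 * ((2 * real g)\<^sup>2 / (2 * (real M)\<^sup>2)\<^sup>2)"
    unfolding qs power_divide by (intro mult_left_mono divide_right_mono) auto
  also have "\<dots> = 2 * q" using M by (simp add: q_def power2_eq_square field_simps)
  also have "\<dots> \<le> 4 * (q * (1 - q))"
  proof -
    have "(real g)\<^sup>2 \<le> (real M)\<^sup>2" using \<open>g \<in> {1..M}\<close> by (auto intro!: power_mono)
    then have "q \<le> 1 / 2" using M by (simp add: q_def field_simps)
    moreover have "0 \<le> q" by (simp add: q_def)
    ultimately have "q * (1 / 2) \<le> q * (1 - q)" by (intro mult_left_mono) auto
    then show ?thesis by simp
  qed
  finally have "(real M)\<^sup>2 * (s - q)\<^sup>2 \<le> 4 * (q * (1 - q))" by (simp add: power2_commute)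
  then show thesis using that \<open>q \<in> grid M\<close> by blast
qed

lemma grid_approx:
  fixes s :: real
  assumes "1 \<le> M" "0 \<le> s" "s \<le> 1"
  obtains q where "q \<in> grid M" "(real M)\<^sup>2 * (s - q)\<^sup>2 \<le> 4 * (q * (1 - q))"
proof (cases "s \<le> 1 / 2")
  case True
  then show thesis using grid_approx_half[of M s] assms that by blast
next
  case False
  then obtain q where q: "q \<in> grid M" "(real M)\<^sup>2 * (1 - s - q)\<^sup>2 \<le> 4 * (q * (1 - q))"
    using grid_approx_half[of M "1 - s"] assms by auto
  moreover have "1 - s - q = - (s - (1 - q))" by simp
  ultimately have "(real M)\<^sup>2 * (s - (1 - q))\<^sup>2 \<le> 4 * ((1 - q) * (1 - (1 - q)))"
    by (metis diff_diff_eq2 add_diff_cancel_left' mult.commute power2_minus)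
  then show thesis using that[OF grid_symmetric[OF q(1)]] by blast
qed

text \<open>Every \<open>p\<close> is first replaced by the observed frequency \<open>s\<close>, and
  only \<open>s\<close> is compared with the grid; hence one \<open>q\<close> serves all
  \<open>p\<close>. The 4 is the constant of \<open>grid_approx\<close>, since
  \<open>m \<le> M * M\<close>.\<close>

lemma grid_dominates:
  assumes M: "1 \<le> M" "j \<le> m" "m \<le> M * M"
  obtains q where "q \<in> grid M"
    "\<And>p. 0 \<le> p \<Longrightarrow> p \<le> 1 \<Longrightarrow> p ^ j * (1 - p) ^ (m - j) \<le> exp 4 * (q ^ j * (1 - q) ^ (m - j))"
proof -
  define s where "s = (if m = 0 then 0 else real j / real m)"
  have s01: "0 \<le> s" "s \<le> 1" and sm: "s * real m = real j" using M by (auto simp: s_def divide_le_eq_1)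
  obtain q where q: "q \<in> grid M" "(real M)\<^sup>2 * (s - q)\<^sup>2 \<le> 4 * (q * (1 - q))"
    using grid_approx[OF M(1) s01] by blast
  note q01 = grid_bounds[OF q(1)]
  have l: "real (m - j) = (1 - s) * real m" using sm M(2) by (simp add: of_nat_diff algebra_simps)
  have "real j * (s / q - 1) + real (m - j) * ((1 - s) / (1 - q) - 1) = real m * (s - q)\<^sup>2 / (q * (1 - q))"
    unfolding l sm[symmetric] using q01 by (simp add: field_simps power2_eq_square)
  also have "\<dots> \<le> (real M)\<^sup>2 * (s - q)\<^sup>2 / (q * (1 - q))"
  proof -
    have "real m \<le> (real M)\<^sup>2"
      using M(3) by (metis of_nat_le_iff of_nat_mult power2_eq_square)
    then show ?thesis using q01 by (intro divide_right_mono mult_right_mono) auto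
  qed
  also have "\<dots> \<le> 4" using q(2) q01 by (simp add: divide_le_eq)
  finally have le: "exp (real j * (s / q - 1) + real (m - j) * ((1 - s) / (1 - q) - 1)) \<le> exp 4" by simp
  have "p ^ j * (1 - p) ^ (m - j) \<le> exp 4 * (q ^ j * (1 - q) ^ (m - j))" if p: "0 \<le> p" "p \<le> 1" for p
  proof -
    have "p ^ j * (1 - p) ^ (m - j) \<le> s ^ j * (1 - s) ^ (m - j)"
    proof (cases "m = 0")
      case False
      then show ?thesis using power_mult_power_le_max[OF p sm M(2)] by simp
    qed (use M in auto)
    also have "\<dots> \<le> exp (real j * (s / q - 1) + real (m - j) * ((1 - s) / (1 - q) - 1)) * (q ^ j * (1 - q) ^ (m - j))"
      by (rule power_mult_power_le_exp[OF s01 q01])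
    also have "\<dots> \<le> exp 4 * (q ^ j * (1 - q) ^ (m - j))"
      using q01 by (intro mult_right_mono le) auto
    finally show ?thesis .
  qed
  then show thesis using that q(1) by blast
qed

text \<open>Stick-breaking: the last class is split off, the remaining ones being rescaled.\<close>

lemma label_grid:
  assumes "1 \<le> k" "1 \<le> M"
  shows "\<exists>Q :: (nat \<Rightarrow> real) set. finite Q \<and> card Q \<le> (2 * M) ^ (k - 1) \<and>
    (\<forall>q\<in>Q. (\<forall>a\<in>{1..k}. 0 < q a) \<and> (\<Sum>a=1..k. q a) = 1) \<and>
    (\<forall>c. (\<Sum>a=1..k. c a) \<le> M * M \<longrightarrow> (\<exists>q\<in>Q. \<forall>p\<in>label_params k.
       (\<Prod>a=1..k. p a ^ c a) \<le> exp 4 ^ (k - 1) * (\<Prod>a=1..k. q a ^ c a)))"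
  using assms(1)
proof (induction k rule: nat_induct_at_least)
  case base
  show ?case
    by (rule exI[of _ "{\<lambda>_. 1}"]) (auto simp: label_params_def)
next
  case (Suc k)
  from Suc.IH obtain Q :: "(nat \<Rightarrow> real) set" where Q: "finite Q" "card Q \<le> (2 * M) ^ (k - 1)"
    "\<And>q a. q \<in> Q \<Longrightarrow> a \<in> {1..k} \<Longrightarrow> 0 < q a" "\<And>q. q \<in> Q \<Longrightarrow> (\<Sum>a=1..k. q a) = 1"
    "\<And>c. (\<Sum>a=1..k. c a) \<le> M * M \<Longrightarrow> (\<exists>q\<in>Q. \<forall>p\<in>label_params k.
       (\<Prod>a=1..k. p a ^ c a) \<le> exp 4 ^ (k - 1) * (\<Prod>a=1..k. q a ^ c a))" by blast
  \<comment> \<open>\<open>t\<close> is the total mass of the first \<open>k\<close> classes and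
    \<open>q\<close> the conditional law among them.\<close>
  define h where "h = (\<lambda>(t, q) a. if a = Suc k then 1 - t else t * q a :: real)"
  let ?Q = "h ` (grid M \<times> Q)"
  have "card ?Q \<le> card (grid M) * card Q"
    using card_image_le[of "grid M \<times> Q" h] Q(1) by (simp add: card_cartesian_product)
  also have "\<dots> \<le> (2 * M) * (2 * M) ^ (k - 1)"
    by (intro mult_mono card_grid Q) auto
  also have "\<dots> = (2 * M) ^ (Suc k - 1)" using Suc.hyps by (cases k) auto
  finally have card: "card ?Q \<le> (2 * M) ^ (Suc k - 1)" .
  have prob: "(\<forall>a\<in>{1..Suc k}. 0 < q a) \<and> (\<Sum>a=1..Suc k. q a) = 1" if qQ: "q \<in> ?Q" for q
  proof -
    obtain t q' where q: "q = h (t, q')" "t \<in> grid M" "q' \<in> Q" using qQ by auto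
    have "(\<Sum>a=1..k. q a) = (\<Sum>a=1..k. t * q' a)" by (intro sum.cong) (auto simp: q h_def)
    also have "\<dots> = t" using Q(4)[OF q(3)] by (simp add: sum_distrib_left[symmetric])
    finally show ?thesis
      using grid_bounds[OF q(2)] Q(3)[OF q(3)] by (auto simp: q(1) h_def)
  qed
  have dom: "\<exists>q\<in>?Q. \<forall>p\<in>label_params (Suc k).
       (\<Prod>a=1..Suc k. p a ^ c a) \<le> exp 4 ^ (Suc k - 1) * (\<Prod>a=1..Suc k. q a ^ c a)"
    if c: "(\<Sum>a=1..Suc k. c a) \<le> M * M" for c
  proof -
    define j where "j = (\<Sum>a=1..k. c a)"
    define m where "m = (\<Sum>a=1..Suc k. c a)"
    have jm: "j \<le> m" "m - j = c (Suc k)" by (simp_all add: j_def m_def)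
    obtain t where t: "t \<in> grid M"
      "\<And>p. 0 \<le> p \<Longrightarrow> p \<le> 1 \<Longrightarrow> p ^ j * (1 - p) ^ (m - j) \<le> exp 4 * (t ^ j * (1 - t) ^ (m - j))"
      using grid_dominates[OF assms(2) jm(1)] c unfolding m_def by blast
    obtain q where q: "q \<in> Q" "\<And>p. p \<in> label_params k \<Longrightarrow>
       (\<Prod>a=1..k. p a ^ c a) \<le> exp 4 ^ (k - 1) * (\<Prod>a=1..k. q a ^ c a)"
      using Q(5)[of c] c by auto
    \<comment> \<open>A Bernoulli likelihood with \<open>j\<close> successes in \<open>m\<close>
      trials splits off from a \<open>k\<close>-class likelihood. Each class after the first thus
      contributes one grid parameter and one factor \<open>exp 4\<close>.\<close>
    have split: "(\<Prod>a=1..Suc k. h (u, p) a ^ c a) = u ^ j * (1 - u) ^ (m - j) * (\<Prod>a=1..k. p a ^ c a)" for u p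
    proof -
      have "(\<Prod>a=1..k. h (u, p) a ^ c a) = (\<Prod>a=1..k. u ^ c a * p a ^ c a)"
        by (intro prod.cong) (auto simp: h_def power_mult_distrib)
      also have "\<dots> = u ^ j * (\<Prod>a=1..k. p a ^ c a)"
        by (simp add: prod.distrib j_def power_sum)
      finally show ?thesis by (simp add: jm h_def)
    qed
    have "(\<Prod>a=1..Suc k. p a ^ c a) \<le> exp 4 ^ (Suc k - 1) * (\<Prod>a=1..Suc k. h (t, q) a ^ c a)"
      if p: "p \<in> label_params (Suc k)" for p
    proof -
      define u where "u = (\<Sum>a=1..k. p a)"
      have pos: "0 < p a" if "a \<in> {1..Suc k}" for a using label_paramsD[OF p] that by blast
      have u1: "u + p (Suc k) = 1" using label_paramsD(3)[OF p] by (simp add: u_def)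
      then have pS: "p (Suc k) = 1 - u" by simp
      have u0: "0 < u" unfolding u_def using pos Suc.hyps by (intro sum_pos) auto
      then have u: "0 < u" "u \<le> 1" using u1 pos[of "Suc k"] by auto
      define p' where "p' = (\<lambda>a. p a / u)"
      have s: "(\<Sum>a=1..k. p' a) = 1" using u(1) unfolding p'_def u_def by (simp add: sum_divide_distrib[symmetric])
      moreover have "p' a \<le> 1" if "a \<in> {1..k}" for a
        using member_le_sum[of a "{1..k}" p'] that pos u s by (auto simp: p'_def less_imp_le)
      ultimately have p': "p' \<in> label_params k" using pos u by (auto simp: label_params_def p'_def)
      have "(\<Prod>a=1..Suc k. p a ^ c a) = (\<Prod>a=1..Suc k. h (u, p') a ^ c a)"
        using u by (intro prod.cong) (auto simp: h_def p'_def pS)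
      also have "\<dots> = u ^ j * (1 - u) ^ (m - j) * (\<Prod>a=1..k. p' a ^ c a)" by (rule split)
      also have "\<dots> \<le> (exp 4 * (t ^ j * (1 - t) ^ (m - j))) * (exp 4 ^ (k - 1) * (\<Prod>a=1..k. q a ^ c a))"
      proof (rule mult_mono)
        show "u ^ j * (1 - u) ^ (m - j) \<le> exp 4 * (t ^ j * (1 - t) ^ (m - j))" using u by (intro t) auto
        show "(\<Prod>a=1..k. p' a ^ c a) \<le> exp 4 ^ (k - 1) * (\<Prod>a=1..k. q a ^ c a)" by (rule q(2)[OF p'])
        show "0 \<le> (\<Prod>a=1..k. p' a ^ c a)"
          using p' by (intro prod_nonneg) (auto simp: label_params_def less_imp_le)
        show "0 \<le> exp 4 * (t ^ j * (1 - t) ^ (m - j))" using grid_bounds[OF t(1)] by simp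
      qed
      also have "\<dots> = exp 4 ^ (Suc k - 1) * (\<Prod>a=1..Suc k. h (t, q) a ^ c a)"
        unfolding split using Suc.hyps by (cases k) (auto simp: mult_ac)
      finally show ?thesis .
    qed
    then show ?thesis using t(1) q(1) by blast
  qed
  show ?case
    by (rule exI[of _ ?Q], intro conjI) (use card prob dom Q(1) in auto)
qed


subsection \<open>Maximum likelihoods and normalising sums\<close>

lemma edge_params_const: "0 \<le> c \<Longrightarrow> c \<le> 1 \<Longrightarrow> (\<lambda>_ _. c) \<in> edge_params k"
  by (simp add: edge_params_def)

lemma edge_params_nonempty: "edge_params k \<noteq> {}"
  using edge_params_const[of 1 k] by auto

lemma label_params_nonempty: "1 \<le> k \<Longrightarrow> label_params k \<noteq> {}"
proof -
  assume "1 \<le> k"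
  then have "(\<lambda>_. 1 / real k) \<in> label_params k" by (simp add: label_params_def)
  then show ?thesis by blast
qed

lemma bdd_above_cond_lik: "bdd_above ((\<lambda>P. cond_lik n k P x z) ` edge_params k)"
  by (rule bdd_aboveI[of _ 1]) (auto intro: cond_lik_bounds)

lemma bdd_above_label_lik: "bdd_above ((\<lambda>p. label_lik n k p z) ` label_params k)"
  by (rule bdd_aboveI[of _ 1]) (auto intro: label_lik_bounds)

lemma complete_lik_bounds:
  assumes "p \<in> label_params k" "P \<in> edge_params k"
  shows "0 \<le> complete_lik n k p P x z" "complete_lik n k p P x z \<le> 1"
  unfolding complete_lik_def
  using cond_lik_bounds[OF assms(2), of n x z] label_lik_bounds[OF assms(1), of n z]
  by (auto intro!: mult_le_one)

lemma complete_lik_le_max: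
  assumes "p \<in> label_params k" "P \<in> edge_params k"
  shows "complete_lik n k p P x z \<le> max_complete_lik n k x z"
proof -
  have "bdd_above ((\<lambda>(p, P). complete_lik n k p P x z) ` (label_params k \<times> edge_params k))"
    by (rule bdd_aboveI[of _ 1]) (auto intro: complete_lik_bounds)
  from cSUP_upper[OF _ this, of "(p, P)"] show ?thesis
    using assms by (simp add: max_complete_lik_def)
qed

lemma cond_lik_le_max: "P \<in> edge_params k \<Longrightarrow> cond_lik n k P x z \<le> max_cond_lik n k x z"
  unfolding max_cond_lik_def by (rule cSUP_upper[OF _ bdd_above_cond_lik])

lemma label_lik_le_max: "p \<in> label_params k \<Longrightarrow> label_lik n k p z \<le> max_label_lik n k z"
  unfolding max_label_lik_def by (rule cSUP_upper[OF _ bdd_above_label_lik])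

lemma max_cond_lik_pos: "0 < max_cond_lik n k x z"
proof -
  have "0 < cond_lik n k (\<lambda>_ _. 1 / 2) x z" by (auto simp: cond_lik_def intro!: prod_pos)
  also have "\<dots> \<le> max_cond_lik n k x z" by (intro cond_lik_le_max edge_params_const) auto
  finally show ?thesis .
qed

lemma max_label_lik_bounds:
  assumes "1 \<le> k"
  shows "0 < max_label_lik n k z" "max_label_lik n k z \<le> 1"
proof -
  obtain p where "p \<in> label_params k" using label_params_nonempty[OF assms] by blast
  then show "0 < max_label_lik n k z"
    using label_lik_bounds(1) label_lik_le_max by (metis less_le_trans)
  show "max_label_lik n k z \<le> 1"
    unfolding max_label_lik_def
    by (rule cSUP_least[OF label_params_nonempty[OF assms]]) (rule label_lik_bounds)
qed

text \<open>The two factors depend on separate parameters. For the second inequality the suprema are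
  taken one at a time after division by the other factor; it is positive, for labels because
  \<open>label_params\<close> has positive entries and for edges because of the constant parameter
  1/2.\<close>

lemma max_complete_lik_eq:
  assumes "1 \<le> k"
  shows "max_complete_lik n k x z = max_cond_lik n k x z * max_label_lik n k z"
proof (rule antisym)
  show "max_complete_lik n k x z \<le> max_cond_lik n k x z * max_label_lik n k z"
    unfolding max_complete_lik_def
  proof (rule cSUP_least)
    show "label_params k \<times> edge_params k \<noteq> {}"
      using label_params_nonempty[OF assms] edge_params_nonempty by blast
    fix q assume "q \<in> label_params k \<times> edge_params k"
    then obtain p P where q: "q = (p, P)" "p \<in> label_params k" "P \<in> edge_params k" by auto
    then show "(case q of (p, P) \<Rightarrow> complete_lik n k p P x z) \<le> max_cond_lik n k x z * max_label_lik n k z"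
      using label_lik_bounds[OF q(2)] max_cond_lik_pos
      by (auto simp: complete_lik_def less_imp_le intro!: mult_mono cond_lik_le_max label_lik_le_max)
  qed
next
  have c: "max_cond_lik n k x z \<le> max_complete_lik n k x z / label_lik n k p z"
    if p: "p \<in> label_params k" for p
    unfolding max_cond_lik_def
  proof (rule cSUP_least[OF edge_params_nonempty])
    fix P assume "P \<in> edge_params k"
    then show "cond_lik n k P x z \<le> max_complete_lik n k x z / label_lik n k p z"
      using complete_lik_le_max[OF p, of P n x z] label_lik_bounds[OF p]
      by (simp add: pos_le_divide_eq complete_lik_def)
  qed
  have "max_label_lik n k z \<le> max_complete_lik n k x z / max_cond_lik n k x z"
    unfolding max_label_lik_def
  proof (rule cSUP_least[OF label_params_nonempty[OF assms]])
    fix p assume "p \<in> label_params k"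
    then show "label_lik n k p z \<le> max_complete_lik n k x z / max_cond_lik n k x z"
      using c label_lik_bounds(1) max_cond_lik_pos by (simp add: pos_le_divide_eq mult.commute)
  qed
  then show "max_cond_lik n k x z * max_label_lik n k z \<le> max_complete_lik n k x z"
    using max_cond_lik_pos[of n k x z] by (simp add: pos_le_divide_eq mult.commute)
qed

text \<open>Resolution \<open>n\<close> suffices because a pair of classes contains at most
  \<open>n * n\<close> edges. Indexing by the sorted pair makes the matrices symmetric, hence
  admissible parameters.\<close>

definition edge_grid :: "nat \<Rightarrow> nat \<Rightarrow> (nat \<Rightarrow> nat \<Rightarrow> real) set" where
  "edge_grid n k = (\<lambda>g a b. g (min a b, max a b)) ` (class_pairs k \<rightarrow>\<^sub>E grid n)"

lemma finite_edge_grid [simp]: "finite (edge_grid n k)"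
  by (simp add: edge_grid_def finite_PiE)

lemma card_edge_grid: "card (edge_grid n k) \<le> (2 * n) ^ card (class_pairs k)"
proof -
  have "card (edge_grid n k) \<le> card (class_pairs k \<rightarrow>\<^sub>E grid n)"
    unfolding edge_grid_def by (intro card_image_le finite_PiE) auto
  also have "\<dots> = card (grid n) ^ card (class_pairs k)" by (simp add: card_PiE)
  also have "\<dots> \<le> (2 * n) ^ card (class_pairs k)" by (intro power_mono card_grid) simp
  finally show ?thesis .
qed

lemma edge_grid_subset: "edge_grid n k \<subseteq> edge_params k"
proof
  fix P assume "P \<in> edge_grid n k"
  then obtain g where g: "P = (\<lambda>a b. g (min a b, max a b))" "g \<in> class_pairs k \<rightarrow>\<^sub>E grid n"
    by (auto simp: edge_grid_def)
  have "0 < P a b \<and> P a b < 1" if "a \<in> {1..k}" "b \<in> {1..k}" for a b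
  proof -
    have "(min a b, max a b) \<in> class_pairs k" using that by (auto simp: class_pairs_def)
    then have "P a b \<in> grid n" using PiE_mem[OF g(2)] by (simp add: g(1))
    then show ?thesis using grid_bounds by blast
  qed
  then show "P \<in> edge_params k"
    by (auto simp: edge_params_def g(1) min.commute max.commute less_imp_le)
qed

text \<open>\<open>cond_lik\<close> is a product of one Bernoulli likelihood per pair of classes, so
  \<open>grid_dominates\<close> applies factor by factor. The point \<open>Q\<close> depends on
  \<open>x\<close> and \<open>z\<close>; users of this lemma therefore sum over the whole
  grid.\<close>

lemma edge_grid_dominates:
  assumes n: "1 \<le> n" and x: "x \<in> networks n"
  shows "\<exists>Q\<in>edge_grid n k. max_cond_lik n k x z \<le> exp 4 ^ card (class_pairs k) * cond_lik n k Q x z"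
proof -
  have "\<exists>q\<in>grid n. \<forall>p. 0 \<le> p \<longrightarrow> p \<le> 1 \<longrightarrow>
      p ^ o_pair n x z (fst c) (snd c) * (1 - p) ^ (n_pair n z (fst c) (snd c) - o_pair n x z (fst c) (snd c))
      \<le> exp 4 * (q ^ o_pair n x z (fst c) (snd c) * (1 - q) ^ (n_pair n z (fst c) (snd c) - o_pair n x z (fst c) (snd c)))"
    if "c \<in> class_pairs k" for c
  proof -
    have "fst c \<le> snd c" using that by (auto simp: class_pairs_def)
    then show ?thesis
      using grid_dominates[OF n o_pair_le_n_pair[OF x] n_pair_le] by metis
  qed
  then obtain g where g: "\<And>c. c \<in> class_pairs k \<Longrightarrow> g c \<in> grid n"
    "\<And>c p. c \<in> class_pairs k \<Longrightarrow> 0 \<le> p \<Longrightarrow> p \<le> 1 \<Longrightarrow>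
      p ^ o_pair n x z (fst c) (snd c) * (1 - p) ^ (n_pair n z (fst c) (snd c) - o_pair n x z (fst c) (snd c))
      \<le> exp 4 * (g c ^ o_pair n x z (fst c) (snd c) * (1 - g c) ^ (n_pair n z (fst c) (snd c) - o_pair n x z (fst c) (snd c)))"
    by metis
  define Q where "Q = (\<lambda>a b. restrict g (class_pairs k) (min a b, max a b))"
  have cl: "cond_lik n k P x z = (\<Prod>c\<in>class_pairs k. P (fst c) (snd c) ^ o_pair n x z (fst c) (snd c) *
      (1 - P (fst c) (snd c)) ^ (n_pair n z (fst c) (snd c) - o_pair n x z (fst c) (snd c)))" for P
    by (simp add: cond_lik_def class_pairs_def prod.Sigma case_prod_beta)
  have "Q \<in> edge_grid n k"
    unfolding edge_grid_def Q_def by (rule imageI) (use g(1) in auto)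
  moreover have "max_cond_lik n k x z \<le> exp 4 ^ card (class_pairs k) * cond_lik n k Q x z"
    unfolding max_cond_lik_def
  proof (rule cSUP_least[OF edge_params_nonempty])
    fix P assume P: "P \<in> edge_params k"
    have "cond_lik n k P x z \<le> (\<Prod>c\<in>class_pairs k. exp 4 * (Q (fst c) (snd c) ^ o_pair n x z (fst c) (snd c) *
      (1 - Q (fst c) (snd c)) ^ (n_pair n z (fst c) (snd c) - o_pair n x z (fst c) (snd c))))"
      unfolding cl
    proof (rule prod_mono)
      fix c assume c: "c \<in> class_pairs k"
      then have "Q (fst c) (snd c) = g c" by (auto simp: Q_def class_pairs_def min_def max_def)
      moreover have "0 \<le> P (fst c) (snd c)" "P (fst c) (snd c) \<le> 1"
        using c edge_paramsD[OF P, of "fst c" "snd c"] by (auto simp: class_pairs_def)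
      ultimately show "0 \<le> P (fst c) (snd c) ^ o_pair n x z (fst c) (snd c) *
          (1 - P (fst c) (snd c)) ^ (n_pair n z (fst c) (snd c) - o_pair n x z (fst c) (snd c)) \<and>
          P (fst c) (snd c) ^ o_pair n x z (fst c) (snd c) *
          (1 - P (fst c) (snd c)) ^ (n_pair n z (fst c) (snd c) - o_pair n x z (fst c) (snd c))
          \<le> exp 4 * (Q (fst c) (snd c) ^ o_pair n x z (fst c) (snd c) *
          (1 - Q (fst c) (snd c)) ^ (n_pair n z (fst c) (snd c) - o_pair n x z (fst c) (snd c)))"
        using g(2)[OF c] by simp
    qed
    also have "\<dots> = exp 4 ^ card (class_pairs k) * cond_lik n k Q x z"
      unfolding cl by (simp add: prod.distrib)
    finally show "cond_lik n k P x z \<le> exp 4 ^ card (class_pairs k) * cond_lik n k Q x z" .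
  qed
  ultimately show ?thesis by blast
qed

lemma sum_max_cond_lik_bounds:
  assumes n: "1 \<le> n" and z: "z \<in> labelings n k"
  shows "1 \<le> (\<Sum>y\<in>networks n. max_cond_lik n k y z)"
    and "(\<Sum>y\<in>networks n. max_cond_lik n k y z)
      \<le> (2 * exp 4) ^ card (class_pairs k) * real n powr (real (k * (k + 1)) / 2)"
proof -
  let ?c = "card (class_pairs k)"
  have "1 = (\<Sum>y\<in>networks n. cond_lik n k (\<lambda>_ _. 1) y z)"
    using sum_networks_cond_lik[OF z edge_params_const[of 1]] by simp
  also have "\<dots> \<le> (\<Sum>y\<in>networks n. max_cond_lik n k y z)"
    by (intro sum_mono cond_lik_le_max edge_params_const) auto
  finally show "1 \<le> (\<Sum>y\<in>networks n. max_cond_lik n k y z)" .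
  have "(\<Sum>y\<in>networks n. max_cond_lik n k y z)
      \<le> (\<Sum>y\<in>networks n. \<Sum>Q\<in>edge_grid n k. exp 4 ^ ?c * cond_lik n k Q y z)"
  proof (rule sum_mono)
    fix y assume "y \<in> networks n"
    then obtain Q where Q: "Q \<in> edge_grid n k" "max_cond_lik n k y z \<le> exp 4 ^ ?c * cond_lik n k Q y z"
      using edge_grid_dominates[OF n] by blast
    then have "exp 4 ^ ?c * cond_lik n k Q y z \<le> (\<Sum>Q\<in>edge_grid n k. exp 4 ^ ?c * cond_lik n k Q y z)"
      using edge_grid_subset
      by (intro member_le_sum[of Q "edge_grid n k" "\<lambda>Q. exp 4 ^ ?c * cond_lik n k Q y z"])
         (auto intro!: mult_nonneg_nonneg cond_lik_bounds)
    then show "max_cond_lik n k y z \<le> (\<Sum>Q\<in>edge_grid n k. exp 4 ^ ?c * cond_lik n k Q y z)"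
      using Q(2) by linarith
  qed
  also have "\<dots> = (\<Sum>Q\<in>edge_grid n k. exp 4 ^ ?c * (\<Sum>y\<in>networks n. cond_lik n k Q y z))"
    by (subst sum.swap) (simp add: sum_distrib_left)
  also have "\<dots> = (\<Sum>Q\<in>edge_grid n k. exp 4 ^ ?c)"
    using edge_grid_subset sum_networks_cond_lik[OF z] by (intro sum.cong) auto
  also have "\<dots> \<le> real ((2 * n) ^ ?c) * exp 4 ^ ?c"
    using card_edge_grid[of n k] by (simp del: of_nat_power of_nat_mult)
  also have "\<dots> = (2 * exp 4) ^ ?c * real n ^ ?c" by (simp add: power_mult_distrib)
  also have "real n ^ ?c = real n powr (real (k * (k + 1)) / 2)"
  proof -
    have "real (k * (k + 1)) / 2 = real ?c"
      using card_class_pairs[of k] by (metis nonzero_mult_div_cancel_left of_nat_mult of_nat_numeral zero_neq_numeral)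
    then show ?thesis using n by (simp add: powr_realpow)
  qed
  finally show "(\<Sum>y\<in>networks n. max_cond_lik n k y z)
      \<le> (2 * exp 4) ^ ?c * real n powr (real (k * (k + 1)) / 2)" .
qed

lemma sum_max_label_lik_bounds:
  assumes n: "1 \<le> n" and k: "1 \<le> k"
  shows "1 \<le> (\<Sum>e\<in>labelings n k. max_label_lik n k e)"
    and "(\<Sum>e\<in>labelings n k. max_label_lik n k e) \<le> (4 * exp 4) ^ (k - 1) * real n powr (real (k - 1) / 2)"
proof -
  obtain p where p: "p \<in> label_params k" using label_params_nonempty[OF k] by blast
  have "1 = (\<Sum>e\<in>labelings n k. label_lik n k p e)"
    using sum_labelings_label_lik[OF label_paramsD(3)[OF p]] by simp
  also have "\<dots> \<le> (\<Sum>e\<in>labelings n k. max_label_lik n k e)"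
    by (intro sum_mono label_lik_le_max p)
  finally show "1 \<le> (\<Sum>e\<in>labelings n k. max_label_lik n k e)" .
  \<comment> \<open>The label counts add up to \<open>n\<close>, so \<open>M * M \<ge> n\<close> is
    enough; this square root produces the exponent \<open>(k - 1) / 2\<close>.\<close>
  define M where "M = nat \<lceil>sqrt (real n)\<rceil>"
  have s1: "1 \<le> sqrt (real n)" using n by simp
  have M: "sqrt (real n) \<le> real M" "real M \<le> 2 * sqrt (real n)"
    using s1 by (auto simp: M_def; linarith)+
  have "1 \<le> real M" using M(1) s1 by linarith
  then have M1: "1 \<le> M" by simp
  have "real n \<le> real M * real M"
    using mult_mono[OF M(1) M(1)] by simp
  then have nM: "n \<le> M * M" by (metis of_nat_le_iff of_nat_mult)
  obtain Q :: "(nat \<Rightarrow> real) set" where Q: "finite Q" "card Q \<le> (2 * M) ^ (k - 1)"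
    "\<And>q a. q \<in> Q \<Longrightarrow> a \<in> {1..k} \<Longrightarrow> 0 < q a" "\<And>q. q \<in> Q \<Longrightarrow> (\<Sum>a=1..k. q a) = 1"
    "\<And>c. (\<Sum>a=1..k. c a) \<le> M * M \<Longrightarrow> (\<exists>q\<in>Q. \<forall>p\<in>label_params k.
       (\<Prod>a=1..k. p a ^ c a) \<le> exp 4 ^ (k - 1) * (\<Prod>a=1..k. q a ^ c a))"
    using label_grid[OF k M1] by blast
  have pos: "0 \<le> label_lik n k q e" if "q \<in> Q" for q e
    unfolding label_lik_def using Q(3)[OF that] by (intro prod_nonneg) (auto simp: less_imp_le)
  have "(\<Sum>e\<in>labelings n k. max_label_lik n k e)
      \<le> (\<Sum>e\<in>labelings n k. \<Sum>q\<in>Q. exp 4 ^ (k - 1) * label_lik n k q e)"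
  proof (rule sum_mono)
    fix e assume e: "e \<in> labelings n k"
    have "(\<Sum>a=1..k. n_lab n e a) = (\<Sum>a=1..k. \<Sum>i\<in>{i\<in>{1..n}. e i = a}. 1)"
      by (simp add: n_lab_eq_card)
    also have "\<dots> = (\<Sum>i=1..n. 1)"
      by (rule sum.group) (use labelingsD[OF e] in auto)
    finally have "(\<Sum>a=1..k. n_lab n e a) \<le> M * M" using nM by simp
    from Q(5)[OF this] obtain q where q: "q \<in> Q"
      "\<And>p. p \<in> label_params k \<Longrightarrow> label_lik n k p e \<le> exp 4 ^ (k - 1) * label_lik n k q e"
      unfolding label_lik_def by blast
    have "max_label_lik n k e \<le> exp 4 ^ (k - 1) * label_lik n k q e"
      unfolding max_label_lik_def by (rule cSUP_least[OF label_params_nonempty[OF k]]) (rule q(2))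
    also have "\<dots> \<le> (\<Sum>q\<in>Q. exp 4 ^ (k - 1) * label_lik n k q e)"
      by (rule member_le_sum[OF q(1)]) (use pos Q(1) in auto)
    finally show "max_label_lik n k e \<le> (\<Sum>q\<in>Q. exp 4 ^ (k - 1) * label_lik n k q e)" .
  qed
  also have "\<dots> = (\<Sum>q\<in>Q. exp 4 ^ (k - 1) * (\<Sum>e\<in>labelings n k. label_lik n k q e))"
    by (subst sum.swap) (simp add: sum_distrib_left)
  also have "\<dots> = (\<Sum>q\<in>Q. exp 4 ^ (k - 1))"
    using Q(4) sum_labelings_label_lik by (intro sum.cong) auto
  also have "\<dots> \<le> real ((2 * M) ^ (k - 1)) * exp 4 ^ (k - 1)"
    using Q(2) by (simp del: of_nat_power of_nat_mult)
  also have "\<dots> = (2 * real M) ^ (k - 1) * exp 4 ^ (k - 1)" by simp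
  also have "\<dots> \<le> (4 * sqrt (real n)) ^ (k - 1) * exp 4 ^ (k - 1)"
    using M by (intro mult_right_mono power_mono) auto
  also have "\<dots> = (4 * exp 4) ^ (k - 1) * sqrt (real n) ^ (k - 1)" by (simp add: power_mult_distrib)
  also have "sqrt (real n) ^ (k - 1) = real n powr (real (k - 1) / 2)"
  proof -
    have "sqrt (real n) ^ (k - 1) = (real n powr (1 / 2)) powr real (k - 1)"
      using n by (simp add: powr_half_sqrt powr_realpow)
    then show ?thesis by (simp add: powr_powr)
  qed
  finally show "(\<Sum>e\<in>labelings n k. max_label_lik n k e)
      \<le> (4 * exp 4) ^ (k - 1) * real n powr (real (k - 1) / 2)" .
qed

lemma sum_sum_max_complete_lik:
  assumes "1 \<le> k"
  shows "(\<Sum>e\<in>labelings n k. \<Sum>y\<in>networks n. max_complete_lik n k y e) =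
    (\<Sum>e\<in>labelings n k. max_label_lik n k e * (\<Sum>y\<in>networks n. max_cond_lik n k y e))"
  using assms by (simp add: max_complete_lik_eq sum_distrib_left mult.commute)

text \<open>What the consistency proof uses of either criterion. The constant \<open>K\<close> may
  depend on \<open>k\<close> and is applied only at \<open>k0\<close>; the mass bound and
  \<open>R \<le> max_complete_lik\<close> hold without constants and are applied at the selected
  \<open>k\<close>. The exponent counts half the logarithm of the sample size per free parameter:
  \<open>k * (k + 1) / 2\<close> edge probabilities with up to \<open>n\<^sup>2\<close> observations
  and \<open>k - 1\<close> label probabilities with \<open>n\<close>.\<close>

definition normalised_score ::
  "(nat \<Rightarrow> nat \<Rightarrow> (nat \<Rightarrow> nat \<Rightarrow> nat) \<Rightarrow> (nat \<Rightarrow> nat) \<Rightarrow> real) \<Rightarrow> bool" where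
  "normalised_score R \<longleftrightarrow>
     (\<forall>n\<ge>1. \<forall>k\<ge>1. (\<Sum>x\<in>networks n. \<Sum>z\<in>labelings n k. R n k x z) \<le> 1) \<and>
     (\<forall>k\<ge>1. \<exists>K>0. \<forall>n\<ge>1. \<forall>x\<in>networks n. \<forall>z\<in>labelings n k.
        0 < R n k x z \<and> R n k x z \<le> max_complete_lik n k x z \<and>
        max_complete_lik n k x z \<le> K * real n powr (real (k * (k + 1)) / 2 + real (k - 1) / 2) * R n k x z)"

lemma normalised_scoreD:
  assumes "normalised_score R"
  shows "1 \<le> n \<Longrightarrow> 1 \<le> k \<Longrightarrow> (\<Sum>x\<in>networks n. \<Sum>z\<in>labelings n k. R n k x z) \<le> 1"
    and "1 \<le> k \<Longrightarrow> \<exists>K>0. \<forall>n\<ge>1. \<forall>x\<in>networks n. \<forall>z\<in>labelings n k.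
        0 < R n k x z \<and> R n k x z \<le> max_complete_lik n k x z \<and>
        max_complete_lik n k x z \<le> K * real n powr (real (k * (k + 1)) / 2 + real (k - 1) / 2) * R n k x z"
  using assms unfolding normalised_score_def by simp_all

text \<open>The denominator \<open>D\<close> may depend on the labels, as it does for
  \<open>DNML\<close>, whose edge factor is normalised separately for each labeling.\<close>

lemma normalised_scoreI:
  assumes sum: "\<And>n k. 1 \<le> n \<Longrightarrow> 1 \<le> k \<Longrightarrow> (\<Sum>x\<in>networks n. \<Sum>z\<in>labelings n k. R n k x z) \<le> 1"
    and R: "\<And>n k x z. 1 \<le> n \<Longrightarrow> 1 \<le> k \<Longrightarrow> x \<in> networks n \<Longrightarrow> z \<in> labelings n k \<Longrightarrow>
      R n k x z = max_complete_lik n k x z / D n k z"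
    and D: "\<And>n k z. 1 \<le> n \<Longrightarrow> 1 \<le> k \<Longrightarrow> z \<in> labelings n k \<Longrightarrow> 1 \<le> D n k z"
      "\<And>n k z. 1 \<le> n \<Longrightarrow> 1 \<le> k \<Longrightarrow> z \<in> labelings n k \<Longrightarrow> D n k z \<le>
         ((2 * exp 4) ^ card (class_pairs k) * real n powr (real (k * (k + 1)) / 2)) *
         ((4 * exp 4) ^ (k - 1) * real n powr (real (k - 1) / 2))"
  shows "normalised_score R"
  unfolding normalised_score_def
proof (intro conjI allI impI)
  fix n k :: nat assume "1 \<le> n" "1 \<le> k"
  then show "(\<Sum>x\<in>networks n. \<Sum>z\<in>labelings n k. R n k x z) \<le> 1" by (rule sum)
next
  fix k :: nat assume k: "1 \<le> k"
  let ?K = "(2 * exp 4) ^ card (class_pairs k) * (4 * exp 4) ^ (k - 1) :: real"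
  show "\<exists>K>0. \<forall>n\<ge>1. \<forall>x\<in>networks n. \<forall>z\<in>labelings n k.
        0 < R n k x z \<and> R n k x z \<le> max_complete_lik n k x z \<and>
        max_complete_lik n k x z \<le> K * real n powr (real (k * (k + 1)) / 2 + real (k - 1) / 2) * R n k x z"
  proof (intro exI[of _ ?K] conjI allI impI ballI)
    fix n x z assume *: "1 \<le> n" "x \<in> networks n" "z \<in> labelings n k"
    have m: "0 < max_complete_lik n k x z"
      using max_cond_lik_pos max_label_lik_bounds[OF k] by (simp add: max_complete_lik_eq[OF k])
    note R = R[OF *(1) k *(2,3)] and D = D[OF *(1) k *(3)]
    show Rpos: "0 < R n k x z" "R n k x z \<le> max_complete_lik n k x z"
      using m D(1) by (auto simp: R divide_le_eq)
    have "max_complete_lik n k x z = D n k z * R n k x z" using D(1) by (simp add: R)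
    also have "\<dots> \<le> (((2 * exp 4) ^ card (class_pairs k) * real n powr (real (k * (k + 1)) / 2)) *
         ((4 * exp 4) ^ (k - 1) * real n powr (real (k - 1) / 2))) * R n k x z"
      using D(2) Rpos by (intro mult_right_mono) auto
    finally show "max_complete_lik n k x z \<le>
        ?K * real n powr (real (k * (k + 1)) / 2 + real (k - 1) / 2) * R n k x z"
      by (simp only: powr_add mult_ac)
  qed simp
qed

lemma normalised_score_NMCL: "normalised_score NMCL"
proof (rule normalised_scoreI[where D =
      "\<lambda>n k _. \<Sum>e\<in>labelings n k. \<Sum>y\<in>networks n. max_complete_lik n k y e"])
  fix n k :: nat assume n: "1 \<le> n" and k: "1 \<le> k"
  let ?L = "\<Sum>e\<in>labelings n k. max_label_lik n k e"
  let ?B = "(2 * exp 4) ^ card (class_pairs k) * real n powr (real (k * (k + 1)) / 2)"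
  let ?D = "\<Sum>e\<in>labelings n k. \<Sum>y\<in>networks n. max_complete_lik n k y e"
  have pos: "0 \<le> max_label_lik n k e" for e using max_label_lik_bounds[OF k] by (simp add: less_imp_le)
  have "?L = (\<Sum>e\<in>labelings n k. max_label_lik n k e * 1)" by simp
  also have "\<dots> \<le> ?D"
    unfolding sum_sum_max_complete_lik[OF k]
    by (intro sum_mono mult_left_mono sum_max_cond_lik_bounds n pos)
  finally show D1: "1 \<le> ?D" using sum_max_label_lik_bounds(1)[OF n k] by linarith
  have "?D \<le> (\<Sum>e\<in>labelings n k. max_label_lik n k e * ?B)"
    unfolding sum_sum_max_complete_lik[OF k]
    by (intro sum_mono mult_left_mono sum_max_cond_lik_bounds n pos)
  also have "\<dots> = ?B * ?L" by (simp only: sum_distrib_right[symmetric] mult.commute)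
  also have "\<dots> \<le> ?B * ((4 * exp 4) ^ (k - 1) * real n powr (real (k - 1) / 2))"
    by (intro mult_left_mono sum_max_label_lik_bounds n k) auto
  finally show "?D \<le> ?B * ((4 * exp 4) ^ (k - 1) * real n powr (real (k - 1) / 2))" .
  have "(\<Sum>x\<in>networks n. \<Sum>z\<in>labelings n k. NMCL n k x z) = ?D / ?D"
    unfolding NMCL_def by (subst sum.swap) (simp add: sum_divide_distrib)
  then show "(\<Sum>x\<in>networks n. \<Sum>z\<in>labelings n k. NMCL n k x z) \<le> 1" using D1 by simp
qed (simp add: NMCL_def)

lemma normalised_score_DNML: "normalised_score DNML"
proof (rule normalised_scoreI)
  fix n k :: nat assume n: "1 \<le> n" and k: "1 \<le> k"
  let ?L = "\<Sum>e\<in>labelings n k. max_label_lik n k e"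
  let ?C = "\<lambda>z. \<Sum>y\<in>networks n. max_cond_lik n k y z"
  have C: "1 \<le> ?C z" if "z \<in> labelings n k" for z by (rule sum_max_cond_lik_bounds[OF n that])
  have L: "1 \<le> ?L" by (rule sum_max_label_lik_bounds[OF n k])
  have "(\<Sum>x\<in>networks n. \<Sum>z\<in>labelings n k. DNML n k x z) =
      (\<Sum>z\<in>labelings n k. ?C z / ?C z * (max_label_lik n k z / ?L))"
    unfolding DNML_def
    by (subst sum.swap) (simp only: sum_distrib_right[symmetric] sum_divide_distrib[symmetric])
  also have "\<dots> = (\<Sum>z\<in>labelings n k. max_label_lik n k z / ?L)"
  proof (rule sum.cong, goal_cases)
    case (2 z)
    then show ?case using C[of z] by simp
  qed simp
  also have "\<dots> = 1" using L by (simp add: sum_divide_distrib[symmetric])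
  finally show "(\<Sum>x\<in>networks n. \<Sum>z\<in>labelings n k. DNML n k x z) \<le> 1" by simp
  fix z assume z: "z \<in> labelings n k"
  show "1 \<le> ?C z * ?L" using mult_mono[OF C[OF z] L] C[OF z] by simp
  show "?C z * ?L \<le> ((2 * exp 4) ^ card (class_pairs k) * real n powr (real (k * (k + 1)) / 2)) *
      ((4 * exp 4) ^ (k - 1) * real n powr (real (k - 1) / 2))"
    using L by (intro mult_mono sum_max_cond_lik_bounds sum_max_label_lik_bounds n k z) auto
qed (simp add: DNML_def max_complete_lik_eq)


subsection \<open>The law of the observed network\<close>

lemma pmf_label_pmf:
  assumes "p \<in> label_params k"
  shows "pmf (label_pmf k p) a = (if a \<in> {1..k} then p a else 0)"
  unfolding label_pmf_def
proof (rule pmf_embed_pmf)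
  show "0 \<le> (if x \<in> {1..k} then p x else 0)" for x
    using label_paramsD[OF assms] by (auto simp: less_imp_le)
  have "(\<integral>\<^sup>+x. ennreal (if x \<in> {1..k} then p x else 0) \<partial>count_space UNIV) =
      (\<Sum>x\<in>{1..k}. ennreal (if x \<in> {1..k} then p x else 0))"
    by (rule nn_integral_count_space') auto
  also have "\<dots> = ennreal (\<Sum>x\<in>{1..k}. p x)"
    using label_paramsD[OF assms] by (subst sum_ennreal[symmetric]) (auto simp: less_imp_le)
  finally show "(\<integral>\<^sup>+x. ennreal (if x \<in> {1..k} then p x else 0) \<partial>count_space UNIV) = 1"
    using label_paramsD(3)[OF assms] by simp
qed

lemma set_Pi_label_pmf:
  assumes "p \<in> label_params k"
  shows "set_pmf (Pi_pmf {1..n} undefined (\<lambda>_. label_pmf k p)) \<subseteq> labelings n k"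
proof -
  have "set_pmf (label_pmf k p) \<subseteq> {1..k}"
    by (auto simp: set_pmf_eq pmf_label_pmf[OF assms])
  then show ?thesis
    by (auto simp: set_Pi_pmf PiE_dflt_def labelings_def PiE_def extensional_def)
qed

lemma pmf_edges_network:
  assumes z: "z \<in> labelings n k" and P: "P \<in> edge_params k" and x: "x \<in> networks n"
  shows "pmf (map_pmf (\<lambda>e i j. of_bool (e (i, j) \<or> e (j, i)))
      (Pi_pmf (edges n) False (\<lambda>(i, j). bernoulli_pmf (P (z i) (z j))))) x = cond_lik n k P x z"
proof -
  let ?net = "\<lambda>e i j. of_bool (e (i, j) \<or> e (j, i)) :: nat"
  let ?Q = "Pi_pmf (edges n) False (\<lambda>(i, j). bernoulli_pmf (P (z i) (z j)))"
  define e0 where "e0 = (\<lambda>e. e \<in> edges n \<and> x (fst e) (snd e) = 1)"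
  \<comment> \<open>The preimage of \<open>x\<close> is unique only on the support: there
    \<open>e\<close> is \<open>False\<close> off the edges, so at most one of the two disjuncts can
    hold.\<close>
  have iff: "?net e = x \<longleftrightarrow> e = e0" if e: "e \<in> set_pmf ?Q" for e
  proof
    have out: "\<not> e c" if "c \<notin> edges n" for c
      using e that set_Pi_pmf_subset[OF finite_edges, of n False] by fastforce
    assume net: "?net e = x"
    show "e = e0"
    proof
      fix c :: "nat \<times> nat"
      obtain i j where c: "c = (i, j)" by (cases c)
      show "e c = e0 c"
      proof (cases "c \<in> edges n")
        case True
        then have "\<not> e (j, i)" using out[of "(j, i)"] by (auto simp: c edges_def)
        moreover have "x i j = of_bool (e (i, j) \<or> e (j, i))" using net by auto
        ultimately show ?thesis using True by (simp add: c e0_def)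
      qed (simp add: out e0_def)
    qed
  next
    assume e: "e = e0"
    show "?net e = x"
    proof (intro ext)
      fix i j
      have x01: "x i j = 0 \<or> x i j = 1" using networks_le_1[OF x, of i j] by linarith
      have "x i j = 0" if "(i, j) \<notin> edges n" "(j, i) \<notin> edges n"
      proof (cases "i \<in> {1..n} \<and> j \<in> {1..n}")
        case True
        then have "i = j" using that by (auto simp: edges_def)
        then show ?thesis using networks_diag[OF x] by simp
      qed (use x in \<open>simp add: networks_def\<close>)
      then show "?net e i j = x i j"
        using networks_sym[OF x, of i j] x01 by (auto simp: e e0_def)
    qed
  qed
  have "pmf (map_pmf ?net ?Q) x = measure ?Q (?net -` {x})" by (rule pmf_map)
  also have "\<dots> = measure ?Q {e0}"
  proof (rule measure_pmf.finite_measure_eq_AE)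
    show "AE e in measure_pmf ?Q. (e \<in> ?net -` {x}) = (e \<in> {e0})"
      unfolding AE_measure_pmf_iff vimage_def using iff by blast
  qed simp_all
  also have "\<dots> = pmf ?Q e0" by (rule measure_pmf_single)
  also have "\<dots> = (\<Prod>e\<in>edges n. pmf (bernoulli_pmf (P (z (fst e)) (z (snd e)))) (e0 e))"
    by (subst pmf_Pi') (auto simp: e0_def case_prod_beta)
  also have "\<dots> = (\<Prod>e\<in>edges n. bern_w (P (z (fst e)) (z (snd e))) (x (fst e) (snd e)))"
  proof (rule prod.cong, goal_cases)
    case (2 e)
    have "x (fst e) (snd e) = 0 \<or> x (fst e) (snd e) = 1"
      using networks_le_1[OF x, of "fst e" "snd e"] by linarith
    then show ?case
      using edge_paramsD[OF P labelingsD[OF z edgesD(1)[OF 2]] labelingsD[OF z edgesD(2)[OF 2]]] 2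
      by (auto simp: bern_w_def e0_def)
  qed simp
  also have "\<dots> = cond_lik n k P x z" by (rule cond_lik_eq_prod_edges[OF x z P, symmetric])
  finally show ?thesis .
qed

definition net_prob ::
  "nat \<Rightarrow> nat \<Rightarrow> (nat \<Rightarrow> real) \<Rightarrow> (nat \<Rightarrow> nat \<Rightarrow> real) \<Rightarrow> (nat \<Rightarrow> nat \<Rightarrow> nat) \<Rightarrow> real" where
  "net_prob n k p P x = (\<Sum>z\<in>labelings n k. complete_lik n k p P x z)"

lemma pmf_sbm_network:
  assumes p: "p \<in> label_params k" and P: "P \<in> edge_params k" and x: "x \<in> networks n"
  shows "pmf (map_pmf snd (sbm_pmf n k p P)) x = net_prob n k p P x"
proof -
  let ?L = "Pi_pmf {1..n} undefined (\<lambda>_. label_pmf k p)"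
  let ?N = "\<lambda>z. map_pmf (\<lambda>e i j. of_bool (e (i, j) \<or> e (j, i)))
      (Pi_pmf (edges n) False (\<lambda>(i, j). bernoulli_pmf (P (z i) (z j)))) :: (nat \<Rightarrow> nat \<Rightarrow> nat) pmf"
  have "map_pmf snd (sbm_pmf n k p P) = bind_pmf ?L ?N"
    by (simp add: sbm_pmf_def map_pmf_def bind_assoc_pmf bind_return_pmf edges_def)
  then have "pmf (map_pmf snd (sbm_pmf n k p P)) x = (\<integral>z. pmf (?N z) x \<partial>measure_pmf ?L)"
    by (simp add: pmf_bind)
  also have "\<dots> = (\<Sum>z\<in>labelings n k. pmf (?N z) x * pmf ?L z)"
    by (rule integral_measure_pmf_real) (use set_Pi_label_pmf[OF p] in auto)
  also have "\<dots> = (\<Sum>z\<in>labelings n k. complete_lik n k p P x z)"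
  proof (rule sum.cong, goal_cases)
    case (2 z)
    have "pmf ?L z = (\<Prod>i=1..n. pmf (label_pmf k p) (z i))"
      using 2 by (intro pmf_Pi') (auto simp: labelings_def)
    also have "\<dots> = (\<Prod>i=1..n. p (z i))"
      using labelingsD[OF 2] by (intro prod.cong) (auto simp: pmf_label_pmf[OF p])
    finally show ?case
      using pmf_edges_network[OF 2 P x] by (simp add: complete_lik_def label_lik_eq_prod[OF 2])
  qed simp
  finally show ?thesis by (simp add: net_prob_def)
qed

lemma prob_sbm_network:
  assumes M: "prob_space M" and A: "sbm_network M n k p P A"
    and p: "p \<in> label_params k" and P: "P \<in> edge_params k" and B: "B \<subseteq> networks n"
  shows "{w \<in> space M. A w \<in> B} \<in> sets M"
    and "measure M {w \<in> space M. A w \<in> B} = (\<Sum>x\<in>B. net_prob n k p P x)"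
proof -
  interpret prob_space M by (rule M)
  have meas: "A \<in> M \<rightarrow>\<^sub>M count_space (networks n)"
    and prob: "\<And>x. x \<in> networks n \<Longrightarrow> measure M {w \<in> space M. A w = x} = net_prob n k p P x"
    using A pmf_sbm_network[OF p P] by (auto simp: sbm_network_def)
  have sets: "{w \<in> space M. A w \<in> C} \<in> sets M" if "C \<subseteq> networks n" for C
    using measurable_sets[OF meas, of C] that by (simp add: vimage_def Int_def conj_commute)
  show "{w \<in> space M. A w \<in> B} \<in> sets M" using sets[OF B] .
  have "finite B" using B finite_networks by (rule finite_subset)
  have "{w \<in> space M. A w \<in> B} = (\<Union>x\<in>B. {w \<in> space M. A w = x})" by auto
  then have "measure M {w \<in> space M. A w \<in> B} = measure M (\<Union>x\<in>B. {w \<in> space M. A w = x})" by simp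
  also have "\<dots> = (\<Sum>x\<in>B. measure M {w \<in> space M. A w = x})"
  proof (rule finite_measure_finite_Union[OF \<open>finite B\<close>])
    show "(\<lambda>x. {w \<in> space M. A w = x}) ` B \<subseteq> sets M"
    proof
      fix S assume "S \<in> (\<lambda>x. {w \<in> space M. A w = x}) ` B"
      then obtain x where "x \<in> B" "S = {w \<in> space M. A w \<in> {x}}" by auto
      then show "S \<in> sets M" using sets[of "{x}"] B by auto
    qed
    show "disjoint_family_on (\<lambda>x. {w \<in> space M. A w = x}) B"
      by (auto simp: disjoint_family_on_def)
  qed
  also have "\<dots> = (\<Sum>x\<in>B. net_prob n k p P x)" using B prob by (intro sum.cong) auto
  finally show "measure M {w \<in> space M. A w \<in> B} = (\<Sum>x\<in>B. net_prob n k p P x)" .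
qed


subsection \<open>Overestimation\<close>

lemma max_label_estimatorD:
  assumes "max_label_estimator zhat" "1 \<le> n" "1 \<le> k" "x \<in> networks n"
  shows "zhat n k x \<in> labelings n k"
    and "z \<in> labelings n k \<Longrightarrow> max_complete_lik n k x z \<le> max_complete_lik n k x (zhat n k x)"
  using assms by (auto simp: max_label_estimator_def is_arg_max_linorder)

text \<open>The law of the network is a sum over \<open>k ^ n\<close> latent labelings, each term
  being at most the maximum. This factor is what the logarithms \<open>ln (real i)\<close> in
  \<open>pen\<close> pay for.\<close>

lemma net_prob_le:
  assumes "max_label_estimator zhat" "1 \<le> n" "1 \<le> k" "x \<in> networks n"
    and "p \<in> label_params k" "P \<in> edge_params k"
  shows "net_prob n k p P x \<le> real k ^ n * max_complete_lik n k x (zhat n k x)"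
proof -
  have "net_prob n k p P x \<le> (\<Sum>z\<in>labelings n k. max_complete_lik n k x (zhat n k x))"
    unfolding net_prob_def
    using complete_lik_le_max[OF assms(5,6)] max_label_estimatorD(2)[OF assms(1-4)]
    by (intro sum_mono) (blast intro: order.trans)
  also have "\<dots> = real k ^ n * max_complete_lik n k x (zhat n k x)" by (simp add: card_labelings)
  finally show ?thesis .
qed

lemma pen_Suc:
  assumes "1 \<le> k"
  shows "pen \<epsilon> (Suc k) n = pen \<epsilon> k n + (real k * (real k + 2) + 1 + \<epsilon>) / 2 * ln (real n) + real n * ln (real k)"
proof -
  have "{1..Suc k - 1} = insert k {1..k - 1}" using assms by auto
  moreover have "k \<notin> {1..k - 1}" using assms by auto
  ultimately show ?thesis by (simp add: pen_def algebra_simps)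
qed

lemma pen_mono:
  assumes "1 \<le> k" "k \<le> l" "1 \<le> n" "0 < \<epsilon>"
  shows "pen \<epsilon> k n \<le> pen \<epsilon> l n"
  using assms(2)
proof (induction l rule: dec_induct)
  case (step l)
  then have "1 \<le> l" using assms by simp
  then have "0 \<le> (real l * (real l + 2) + 1 + \<epsilon>) / 2 * ln (real n)" "0 \<le> real n * ln (real l)"
    using assms by auto
  then show ?case using step.IH pen_Suc[OF \<open>1 \<le> l\<close>, of \<epsilon> n] by linarith
qed simp

text \<open>The mass of the networks on which \<open>k > k0\<close> classes are selected: the true law is dominated by
  the score at \<open>k0\<close> classes up to its normaliser, hence by the score at \<open>k\<close> classes, which has total
  mass at most one.\<close>

lemma overestimation_one:
  assumes R: "normalised_score R" and zhat: "max_label_estimator zhat"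
    and k0: "1 \<le> k0" and p: "p \<in> label_params k0" and P: "P \<in> edge_params k0"
    and n: "k0 \<le> n" "1 \<le> k"
    and khat: "\<And>x. x \<in> networks n \<Longrightarrow>
      is_arg_max (\<lambda>k. ln (R n k x (zhat n k x)) - pen \<epsilon> k n) (\<lambda>k. 1 \<le> k \<and> k \<le> n) (khat x)"
    and K: "0 < K" "\<And>x z. x \<in> networks n \<Longrightarrow> z \<in> labelings n k0 \<Longrightarrow>
      max_complete_lik n k0 x z \<le> K * R n k0 x z"
  shows "(\<Sum>x\<in>{x\<in>networks n. khat x = k}. net_prob n k0 p P x)
    \<le> real k0 ^ n * K * exp (pen \<epsilon> k0 n - pen \<epsilon> k n)"
proof -
  have n1: "1 \<le> n" using k0 n by simp
  have Rpos: "0 < R n k x z" if "1 \<le> k" "x \<in> networks n" "z \<in> labelings n k" for k x z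
    using normalised_scoreD(2)[OF R that(1)] that n1 by metis
  let ?c = "real k0 ^ n * K * exp (pen \<epsilon> k0 n - pen \<epsilon> k n)"
  have c: "0 \<le> ?c" using K by simp
  have "(\<Sum>x\<in>{x\<in>networks n. khat x = k}. net_prob n k0 p P x)
      \<le> (\<Sum>x\<in>{x\<in>networks n. khat x = k}. ?c * R n k x (zhat n k x))"
  proof (rule sum_mono)
    fix x assume "x \<in> {x\<in>networks n. khat x = k}"
    then have x: "x \<in> networks n" "khat x = k" by auto
    note z0 = max_label_estimatorD(1)[OF zhat n1 k0 x(1)]
    note z = max_label_estimatorD(1)[OF zhat n1 n(2) x(1)]
    have "ln (R n k0 x (zhat n k0 x)) - pen \<epsilon> k0 n \<le> ln (R n k x (zhat n k x)) - pen \<epsilon> k n"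
      using khat[OF x(1)] k0 n x(2) by (simp add: is_arg_max_linorder)
    then have "exp (ln (R n k0 x (zhat n k0 x))) \<le> exp ((pen \<epsilon> k0 n - pen \<epsilon> k n) + ln (R n k x (zhat n k x)))"
      by simp
    then have le: "R n k0 x (zhat n k0 x) \<le> exp (pen \<epsilon> k0 n - pen \<epsilon> k n) * R n k x (zhat n k x)"
      using Rpos[OF k0 x(1) z0] Rpos[OF n(2) x(1) z] by (simp add: exp_add)
    have "net_prob n k0 p P x \<le> real k0 ^ n * max_complete_lik n k0 x (zhat n k0 x)"
      by (rule net_prob_le[OF zhat n1 k0 x(1) p P])
    also have "\<dots> \<le> real k0 ^ n * (K * R n k0 x (zhat n k0 x))"
      by (intro mult_left_mono K x z0) auto
    also have "\<dots> \<le> real k0 ^ n * (K * (exp (pen \<epsilon> k0 n - pen \<epsilon> k n) * R n k x (zhat n k x)))"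
      using K(1) by (intro mult_left_mono le) auto
    finally show "net_prob n k0 p P x \<le> ?c * R n k x (zhat n k x)" by (simp add: mult_ac)
  qed
  also have "\<dots> = ?c * (\<Sum>x\<in>{x\<in>networks n. khat x = k}. R n k x (zhat n k x))"
    by (simp add: sum_distrib_left)
  also have "\<dots> \<le> ?c * 1"
  proof (rule mult_left_mono[OF _ c])
    have "(\<Sum>x\<in>{x\<in>networks n. khat x = k}. R n k x (zhat n k x))
        \<le> (\<Sum>x\<in>networks n. R n k x (zhat n k x))"
      using Rpos[OF n(2)] max_label_estimatorD(1)[OF zhat n1 n(2)]
      by (intro sum_mono2) (auto simp: less_imp_le)
    also have "\<dots> \<le> (\<Sum>x\<in>networks n. \<Sum>z\<in>labelings n k. R n k x z)"
      using Rpos[OF n(2)] max_label_estimatorD(1)[OF zhat n1 n(2)]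
      by (intro sum_mono member_le_sum) (auto simp: less_imp_le)
    also have "\<dots> \<le> 1" by (rule normalised_scoreD(1)[OF R n1 n(2)])
    finally show "(\<Sum>x\<in>{x\<in>networks n. khat x = k}. R n k x (zhat n k x)) \<le> 1" .
  qed
  finally show ?thesis by simp
qed

text \<open>For \<open>k = k0 + 1\<close> the powers of \<open>n\<close> in the normaliser at
  \<open>k0\<close> and in the penalty step combine to the exponent
  \<open>- 1 - \<epsilon> / 2\<close>. Any further step of \<open>pen\<close> gains at least another
  factor \<open>1 / n\<close>, so the fewer than \<open>n\<close> remaining candidates together
  contribute no more than the first one; hence the factor 2.\<close>

lemma overestimation:
  assumes R: "normalised_score R" and zhat: "max_label_estimator zhat"
    and k0: "1 \<le> k0" and p: "p \<in> label_params k0" and P: "\<And>n. 1 \<le> n \<Longrightarrow> P n \<in> edge_params k0"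
    and \<epsilon>: "0 < \<epsilon>"
    and khat: "\<And>n x. 1 \<le> n \<Longrightarrow> x \<in> networks n \<Longrightarrow>
      is_arg_max (\<lambda>k. ln (R n k x (zhat n k x)) - pen \<epsilon> k n) (\<lambda>k. 1 \<le> k \<and> k \<le> n) (khat n x)"
  shows "\<exists>K. \<forall>n\<ge>k0. (\<Sum>x\<in>{x\<in>networks n. k0 < khat n x}. net_prob n k0 p (P n) x)
    \<le> K * real n powr (- 1 - \<epsilon> / 2)"
proof -
  let ?e = "real (k0 * (k0 + 1)) / 2 + real (k0 - 1) / 2"
  obtain K where K: "0 < K" "\<And>n x z. 1 \<le> n \<Longrightarrow> x \<in> networks n \<Longrightarrow> z \<in> labelings n k0 \<Longrightarrow>
      max_complete_lik n k0 x z \<le> K * real n powr ?e * R n k0 x z"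
    using normalised_scoreD(2)[OF R k0] by metis
  have "(\<Sum>x\<in>{x\<in>networks n. k0 < khat n x}. net_prob n k0 p (P n) x)
    \<le> 2 * K * real n powr (- 1 - \<epsilon> / 2)" if n: "k0 \<le> n" for n
  proof -
    have n1: "1 \<le> n" using n k0 by simp
    let ?a = "K * real n powr (- 1 - \<epsilon> / 2)"
    let ?S = "\<lambda>k. \<Sum>x\<in>{x\<in>networks n. khat n x = k}. net_prob n k0 p (P n) x"
    have base: "real k0 ^ n * (K * real n powr ?e) * exp (pen \<epsilon> k0 n - pen \<epsilon> (Suc k0) n) = ?a"
    proof -
      have k0n: "real k0 ^ n = exp (real n * ln (real k0))" using k0 by (simp add: exp_of_nat_mult)
      have ne: "real n powr ?e = exp (?e * ln (real n))" "real n powr (- 1 - \<epsilon> / 2) = exp ((- 1 - \<epsilon> / 2) * ln (real n))"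
        using n1 by (simp_all add: powr_def)
      \<comment> \<open>The normaliser exponent at \<open>k0\<close> equals
        \<open>(k0 * (k0 + 2) - 1) / 2\<close>.\<close>
      have ex: "?e = (real k0 * (real k0 + 2) + 1 + \<epsilon>) / 2 + (- 1 - \<epsilon> / 2)"
        using k0 by (simp add: of_nat_diff field_simps)
      have "real n * ln (real k0) + ?e * ln (real n) + (pen \<epsilon> k0 n - pen \<epsilon> (Suc k0) n) = (- 1 - \<epsilon> / 2) * ln (real n)"
        unfolding pen_Suc[OF k0] ex by (simp add: algebra_simps)
      then have "exp (real n * ln (real k0)) * exp (?e * ln (real n)) * exp (pen \<epsilon> k0 n - pen \<epsilon> (Suc k0) n) =
          exp ((- 1 - \<epsilon> / 2) * ln (real n))"
        by (simp only: exp_add[symmetric])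
      then show ?thesis unfolding k0n ne by (simp add: mult_ac)
    qed
    have S: "?S k \<le> real k0 ^ n * (K * real n powr ?e) * exp (pen \<epsilon> k0 n - pen \<epsilon> k n)" if "1 \<le> k" for k
    proof (rule overestimation_one[where khat = "khat n", OF R zhat k0 p P[OF n1] n that])
      show "is_arg_max (\<lambda>k. ln (R n k x (zhat n k x)) - pen \<epsilon> k n) (\<lambda>k. 1 \<le> k \<and> k \<le> n) (khat n x)"
        if "x \<in> networks n" for x by (rule khat[OF n1 that])
      show "0 < K * real n powr ?e" using K(1) n1 by simp
    qed (use K(2) n1 in auto)
    have S1: "?S (Suc k0) \<le> ?a" using S[of "Suc k0"] unfolding base by simp
    have S2: "?S k \<le> ?a / real n" if "k0 + 2 \<le> k" for k
    proof -
      \<comment> \<open>The coefficient of \<open>ln n\<close> at \<open>i = k0 + 1\<close> is at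
        least 1, which pays for the union over \<open>k\<close>.\<close>
      have "pen \<epsilon> (Suc k0) n + 1 * ln (real n) \<le> pen \<epsilon> (Suc (Suc k0)) n"
      proof -
        have "1 * ln (real n) \<le> (real (Suc k0) * (real (Suc k0) + 2) + 1 + \<epsilon>) / 2 * ln (real n)"
        proof (rule mult_right_mono)
          have "real (Suc k0) * (real (Suc k0) + 2) \<ge> 1 * 2" by (intro mult_mono) auto
          then show "1 \<le> (real (Suc k0) * (real (Suc k0) + 2) + 1 + \<epsilon>) / 2" using \<epsilon> by simp
        qed (use n1 in simp)
        moreover have "0 \<le> real n * ln (real (Suc k0))" by simp
        ultimately show ?thesis using pen_Suc[of "Suc k0" \<epsilon> n] by linarith
      qed
      also have "\<dots> \<le> pen \<epsilon> k n" using that n1 \<epsilon> by (intro pen_mono) auto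
      finally have "pen \<epsilon> k0 n - pen \<epsilon> k n \<le> (pen \<epsilon> k0 n - pen \<epsilon> (Suc k0) n) - ln (real n)" by simp
      then have "exp (pen \<epsilon> k0 n - pen \<epsilon> k n) \<le> exp (pen \<epsilon> k0 n - pen \<epsilon> (Suc k0) n) / real n"
        using n1 by (subst (asm) exp_le_cancel_iff[symmetric]) (simp add: exp_diff)
      then have "real k0 ^ n * (K * real n powr ?e) * exp (pen \<epsilon> k0 n - pen \<epsilon> k n) \<le>
         real k0 ^ n * (K * real n powr ?e) * (exp (pen \<epsilon> k0 n - pen \<epsilon> (Suc k0) n) / real n)"
        using K(1) by (intro mult_left_mono) auto
      also have "\<dots> = ?a / real n" unfolding base[symmetric] by simp
      finally show ?thesis using S[of k] that by simp
    qed
    have "(\<Sum>x\<in>{x\<in>networks n. k0 < khat n x}. net_prob n k0 p (P n) x) =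
        (\<Sum>k\<in>{k0<..n}. \<Sum>x\<in>{x\<in>{x\<in>networks n. k0 < khat n x}. khat n x = k}. net_prob n k0 p (P n) x)"
      using khat[OF n1] by (intro sum.group[symmetric]) (auto simp: is_arg_max_linorder)
    also have "\<dots> = (\<Sum>k\<in>{k0<..n}. ?S k)"
      by (intro sum.cong) auto
    also have "\<dots> \<le> (\<Sum>k\<in>{k0<..n}. ?a * of_bool (k = Suc k0) + ?a / real n)"
    proof (rule sum_mono)
      fix k assume k: "k \<in> {k0<..n}"
      have a: "0 \<le> ?a" "0 \<le> ?a / real n" using K(1) by auto
      show "?S k \<le> ?a * of_bool (k = Suc k0) + ?a / real n"
      proof (cases "k = Suc k0")
        case True
        then have "?a * of_bool (k = Suc k0) = ?a" by simp
        moreover have "?S k \<le> ?a" using S1 True by simp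
        ultimately show ?thesis using a(2) by linarith
      next
        case False
        then show ?thesis using S2[of k] k by simp
      qed
    qed
    also have "\<dots> \<le> ?a + ?a"
    proof -
      have "(\<Sum>k\<in>{k0<..n}. ?a * of_bool (k = Suc k0)) = (\<Sum>k\<in>{k0<..n}. if k = Suc k0 then ?a else 0)"
        by (intro sum.cong) auto
      also have "\<dots> \<le> ?a" using K(1) by (subst sum.delta) auto
      finally have "(\<Sum>k\<in>{k0<..n}. ?a * of_bool (k = Suc k0)) \<le> ?a" .
      moreover have "(\<Sum>k\<in>{k0<..n}. ?a / real n) \<le> ?a"
      proof -
        have "real (n - k0) * ?a \<le> real n * ?a" using K(1) by (intro mult_right_mono) auto
        then show ?thesis using n1 by (simp add: field_simps)
      qed
      ultimately show ?thesis by (simp add: sum.distrib)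
    qed
    finally show ?thesis by simp
  qed
  then show ?thesis by blast
qed


subsection \<open>Underestimation\<close>

text \<open>The first root is evaluated exactly, the second bounded by the arithmetic mean. The
  distance that is kept involves only \<open>sqrt p - sqrt q\<close>, which is homogeneous and so
  retains the factor \<open>\<rho> n\<close> in sparse networks.\<close>

lemma bhattacharyya_le:
  assumes "0 \<le> p" "p \<le> 1" "0 \<le> q" "q \<le> 1"
  shows "sqrt (p * q) + sqrt ((1 - p) * (1 - q)) \<le> exp (- ((sqrt p - sqrt q)\<^sup>2 / 2))"
proof -
  have "sqrt (p * q) = (p + q - (sqrt p - sqrt q)\<^sup>2) / 2"
    using assms by (simp add: real_sqrt_mult power2_diff)
  moreover have "sqrt ((1 - p) * (1 - q)) \<le> ((1 - p) + (1 - q)) / 2"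
    using assms by (intro arith_geo_mean_sqrt) auto
  ultimately have "sqrt (p * q) + sqrt ((1 - p) * (1 - q)) \<le> 1 + (- ((sqrt p - sqrt q)\<^sup>2 / 2))" by simp
  also have "\<dots> \<le> exp (- ((sqrt p - sqrt q)\<^sup>2 / 2))" by (rule exp_ge_add_one_self)
  finally show ?thesis .
qed

lemma sum_sqrt_cond_lik_le:
  assumes z: "z \<in> labelings n k" and Q: "Q \<in> edge_params k"
    and y: "y \<in> labelings n l" and P: "P \<in> edge_params l"
  shows "(\<Sum>x\<in>networks n. sqrt (cond_lik n k Q x z * cond_lik n l P x y)) \<le>
    exp (- ((\<Sum>e\<in>edges n. (sqrt (Q (z (fst e)) (z (snd e))) - sqrt (P (y (fst e)) (y (snd e))))\<^sup>2) / 2))"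
proof -
  let ?q = "\<lambda>e. Q (z (fst e)) (z (snd e))" and ?p = "\<lambda>e. P (y (fst e)) (y (snd e))"
  have sqrt_prod: "sqrt (\<Prod>e\<in>E. f e) = (\<Prod>e\<in>E. sqrt (f e))" for f :: "nat \<times> nat \<Rightarrow> real" and E
    by (induction E rule: infinite_finite_induct) (auto simp: real_sqrt_mult)
  have "(\<Sum>x\<in>networks n. sqrt (cond_lik n k Q x z * cond_lik n l P x y)) =
      (\<Sum>x\<in>networks n. \<Prod>e\<in>edges n. sqrt (bern_w (?q e) (x (fst e) (snd e)) * bern_w (?p e) (x (fst e) (snd e))))"
    using cond_lik_eq_prod_edges[OF _ z Q] cond_lik_eq_prod_edges[OF _ y P]
    by (intro sum.cong) (auto simp: prod.distrib[symmetric] sqrt_prod)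
  also have "\<dots> = (\<Prod>e\<in>edges n. sqrt ((1 - ?q e) * (1 - ?p e)) + sqrt (?q e * ?p e))"
    by (subst sum_networks_prod_edges) (simp add: bern_w_def)
  also have "\<dots> \<le> (\<Prod>e\<in>edges n. exp (- ((sqrt (?q e) - sqrt (?p e))\<^sup>2 / 2)))"
  proof (rule prod_mono)
    fix e assume e: "e \<in> edges n"
    have q: "0 \<le> ?q e" "?q e \<le> 1"
      using edge_paramsD[OF Q labelingsD[OF z edgesD(1)[OF e]] labelingsD[OF z edgesD(2)[OF e]]] by auto
    have p: "0 \<le> ?p e" "?p e \<le> 1"
      using edge_paramsD[OF P labelingsD[OF y edgesD(1)[OF e]] labelingsD[OF y edgesD(2)[OF e]]] by auto
    show "0 \<le> sqrt ((1 - ?q e) * (1 - ?p e)) + sqrt (?q e * ?p e) \<and>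
        sqrt ((1 - ?q e) * (1 - ?p e)) + sqrt (?q e * ?p e) \<le> exp (- ((sqrt (?q e) - sqrt (?p e))\<^sup>2 / 2))"
      using bhattacharyya_le[OF q p] q p by auto
  qed
  also have "\<dots> = exp (- ((\<Sum>e\<in>edges n. (sqrt (?q e) - sqrt (?p e))\<^sup>2) / 2))"
    by (simp add: exp_sum[symmetric] sum_negf sum_divide_distrib)
  finally show ?thesis .
qed

text \<open>With fewer than \<open>k0\<close> classes, two true classes \<open>a\<close>, \<open>b\<close> share their most frequent label, and the
  fitted probability cannot match both \<open>T a c\<close> and \<open>T b c\<close>.\<close>

lemma label_separation:
  fixes T :: "nat \<Rightarrow> nat \<Rightarrow> real"
  assumes z0: "z0 \<in> labelings n k0" and z: "z \<in> labelings n k" and k: "1 \<le> k" "k < k0"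
    and Q: "Q \<in> edge_params k"
    and T: "\<And>a b. a \<in> {1..k0} \<Longrightarrow> b \<in> {1..k0} \<Longrightarrow> T a b = T b a"
    and \<eta>: "0 \<le> \<eta>" "\<And>a b. a \<in> {1..k0} \<Longrightarrow> b \<in> {1..k0} \<Longrightarrow> a \<noteq> b \<Longrightarrow> \<exists>c\<in>{1..k0}. \<eta> \<le> (T a c - T b c)\<^sup>2"
    and \<gamma>: "2 \<le> \<gamma>" "\<And>a. a \<in> {1..k0} \<Longrightarrow> \<gamma> * real k0 \<le> real (n_lab n z0 a)"
  shows "\<gamma>\<^sup>2 * \<eta> / 8 \<le> (\<Sum>e\<in>edges n. (sqrt (Q (z (fst e)) (z (snd e))) - T (z0 (fst e)) (z0 (snd e)))\<^sup>2)"
proof -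
  define U where "U = (\<lambda>a l. {i\<in>{1..n}. z0 i = a \<and> z i = l})"
  \<comment> \<open>Otherwise fewer than \<open>\<gamma> * k0\<close> nodes would carry the true
    class \<open>a\<close>, there being only \<open>k < k0\<close> fitted labels.\<close>
  have "\<exists>l\<in>{1..k}. \<gamma> \<le> real (card (U a l))" if a: "a \<in> {1..k0}" for a
  proof (rule ccontr)
    assume neg: "\<not> ?thesis"
    have "n_lab n z0 a = (\<Sum>i\<in>{i\<in>{1..n}. z0 i = a}. 1)" by (simp add: n_lab_eq_card)
    also have "\<dots> = (\<Sum>l\<in>{1..k}. \<Sum>i\<in>{i\<in>{i\<in>{1..n}. z0 i = a}. z i = l}. 1)"
      by (rule sum.group[symmetric]) (use labelingsD[OF z] in auto)
    also have "\<dots> = (\<Sum>l\<in>{1..k}. card (U a l))" by (simp add: U_def conj_assoc)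
    finally have "real (n_lab n z0 a) = (\<Sum>l\<in>{1..k}. real (card (U a l)))" by simp
    also have "\<dots> < (\<Sum>l\<in>{1..k}. \<gamma>)"
    proof (rule sum_strict_mono)
      show "real (card (U a l)) < \<gamma>" if "l \<in> {1..k}" for l using neg that not_le by blast
    qed (use k in auto)
    also have "\<dots> \<le> \<gamma> * real k0" using k \<gamma>(1) by (simp add: mult.commute)
    finally show False using \<gamma>(2)[OF a] by simp
  qed
  then obtain f where f: "\<And>a. a \<in> {1..k0} \<Longrightarrow> f a \<in> {1..k}" "\<And>a. a \<in> {1..k0} \<Longrightarrow> \<gamma> \<le> real (card (U a (f a)))"
    by metis
  have "\<not> inj_on f {1..k0}"
  proof
    assume "inj_on f {1..k0}"
    then have "card {1..k0} \<le> card {1..k}" by (rule card_inj_on_le) (use f(1) in blast, simp)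
    then show False using k by simp
  qed
  then obtain a b where ab: "a \<in> {1..k0}" "b \<in> {1..k0}" "a \<noteq> b" "f a = f b"
    by (auto simp: inj_on_def)
  obtain c where c: "c \<in> {1..k0}" "\<eta> \<le> (T a c - T b c)\<^sup>2" using \<eta>(2)[OF ab(1-3)] by blast
  define V where "V = (\<lambda>a. U a (f a))"
  have V: "V a \<subseteq> {1..n}" "finite (V a)" for a by (auto simp: V_def U_def)
  have cV: "\<gamma> \<le> real (card (V a))" if "a \<in> {1..k0}" for a using f(2)[OF that] by (simp add: V_def)
  \<comment> \<open>Ordered pairs are summed because \<open>c\<close> may coincide with
    \<open>a\<close> or \<open>b\<close>; the zero diagonal reflects the absence of loops.\<close>
  define d where "d = (\<lambda>i j. if i = j then 0 else (sqrt (Q (z i) (z j)) - T (z0 i) (z0 j))\<^sup>2)"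
  have d0: "0 \<le> d i j" for i j by (simp add: d_def)
  define X where "X = (\<lambda>a. (sqrt (Q (f a) (f c)) - T a c)\<^sup>2)"
  have col: "\<gamma> / 2 * X a' \<le> (\<Sum>i\<in>V a'. d i j)" if "j \<in> V c" "a' \<in> {1..k0}" for j a'
  proof -
    \<comment> \<open>The node \<open>j\<close> may itself lie in \<open>V a'\<close> and is then
      lost; \<open>\<gamma> \<ge> 2\<close> absorbs this loss into a factor 1/2.\<close>
    have "\<gamma> / 2 \<le> \<gamma> - 1" using \<gamma>(1) by simp
    also have "\<dots> \<le> real (card (V a')) - 1" using cV[OF that(2)] by simp
    also have "\<dots> \<le> real (card (V a' - {j}))"
    proof -
      have "card (V a') \<le> card (V a' - {j}) + 1"
        using diff_card_le_card_Diff[of "{j}" "V a'"] by simp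
      then have "real (card (V a')) \<le> real (card (V a' - {j}) + 1)" by (simp only: of_nat_le_iff)
      then show ?thesis by simp
    qed
    finally have "\<gamma> / 2 * X a' \<le> real (card (V a' - {j})) * X a'"
      by (rule mult_right_mono) (simp add: X_def)
    also have "\<dots> = (\<Sum>i\<in>V a' - {j}. X a')" by simp
    also have "\<dots> = (\<Sum>i\<in>V a' - {j}. d i j)"
      using that by (intro sum.cong) (auto simp: d_def X_def V_def U_def)
    also have "\<dots> \<le> (\<Sum>i\<in>V a'. d i j)" using V(2) d0 by (intro sum_mono2) auto
    finally show ?thesis .
  qed
  have "\<eta> / 2 \<le> X a + X b"
  proof -
    define u v where "u = sqrt (Q (f a) (f c)) - T a c" and "v = sqrt (Q (f a) (f c)) - T b c"
    have "T a c - T b c = v - u" by (simp add: u_def v_def)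
    then have "\<eta> \<le> (v - u)\<^sup>2" using c(2) by simp
    \<comment> \<open>Parallelogram identity: one fitted value cannot be close to two separated
      targets.\<close>
    then have "\<eta> + 0 \<le> (v - u)\<^sup>2 + (v + u)\<^sup>2" by (intro add_mono) auto
    also have "\<dots> = 2 * (u\<^sup>2 + v\<^sup>2)" by (simp add: power2_eq_square algebra_simps)
    finally have "\<eta> / 2 \<le> u\<^sup>2 + v\<^sup>2" by simp
    then show ?thesis using ab(4) by (simp add: X_def u_def v_def)
  qed
  \<comment> \<open>The denominator 8 arises from the two halves here and from each edge being
    counted in both orders below.\<close>
  then have "\<gamma> * (\<gamma> / 2 * (\<eta> / 2)) \<le> real (card (V c)) * (\<gamma> / 2 * (X a + X b))"
    using cV[OF c(1)] \<gamma>(1) \<eta>(1) by (intro mult_mono) auto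
  also have "\<dots> = (\<Sum>j\<in>V c. \<gamma> / 2 * X a + \<gamma> / 2 * X b)" by (simp add: algebra_simps)
  also have "\<dots> \<le> (\<Sum>j\<in>V c. (\<Sum>i\<in>V a. d i j) + (\<Sum>i\<in>V b. d i j))"
    using ab by (intro sum_mono add_mono col) auto
  also have "\<dots> = (\<Sum>j\<in>V c. \<Sum>i\<in>V a \<union> V b. d i j)"
  proof (intro sum.cong refl sum.union_disjoint[symmetric] V(2))
    show "V a \<inter> V b = {}" using ab(3) by (auto simp: V_def U_def)
  qed
  also have "\<dots> \<le> (\<Sum>j\<in>V c. \<Sum>i=1..n. d i j)"
    using V d0 by (intro sum_mono sum_mono2) auto
  also have "\<dots> \<le> (\<Sum>j=1..n. \<Sum>i=1..n. d i j)"
    using V d0 by (intro sum_mono2) (auto intro: sum_nonneg)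
  also have "\<dots> = (\<Sum>(i, j)\<in>edges n. d j i + d i j)"
    by (rule sum_pairs_eq_sum_edges) (simp add: d_def)
  also have "\<dots> = (\<Sum>e\<in>edges n. 2 * (sqrt (Q (z (fst e)) (z (snd e))) - T (z0 (fst e)) (z0 (snd e)))\<^sup>2)"
  proof (rule sum.cong, goal_cases)
    case (2 e)
    note i = edgesD[OF 2]
    have "Q (z (fst e)) (z (snd e)) = Q (z (snd e)) (z (fst e))"
      by (intro edge_paramsD(3)[OF Q] labelingsD[OF z] i)
    moreover have "T (z0 (fst e)) (z0 (snd e)) = T (z0 (snd e)) (z0 (fst e))"
      by (intro T labelingsD[OF z0] i)
    ultimately show ?case using 2 by (auto simp: d_def edges_def)
  qed simp
  finally show ?thesis by (simp add: sum_distrib_left[symmetric] power2_eq_square)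
qed

text \<open>Chernoff bound with exponential parameter 1: each node labelled \<open>a\<close> gets
  weight \<open>exp (- 1)\<close>. From \<open>exp 1 \<ge> 5/2\<close> one node contributes at most
  \<open>1 - 3/5 * p a\<close>, and \<open>1/2 - 3/5 = - 1/10\<close> gives the rate.\<close>

lemma label_lik_rare_class:
  assumes p: "p \<in> label_params k" and a: "a \<in> {1..k}"
  shows "(\<Sum>z\<in>{z\<in>labelings n k. real (n_lab n z a) < p a / 2 * real n}. label_lik n k p z)
    \<le> exp (- (p a / 10 * real n))"
proof -
  let ?S = "{z\<in>labelings n k. real (n_lab n z a) < p a / 2 * real n}"
  let ?g = "\<lambda>b. p b * exp (- of_bool (b = a)) :: real"
  note pD = label_paramsD[OF p]
  have "(\<Sum>z\<in>?S. label_lik n k p z) \<le> (\<Sum>z\<in>?S. exp (p a / 2 * real n) * (\<Prod>i=1..n. ?g (z i)))"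
  proof (rule sum_mono)
    fix z assume z: "z \<in> ?S"
    have "real (n_lab n z a) = (\<Sum>i=1..n. of_bool (z i = a))" by (simp add: n_lab_def)
    then have "(\<Prod>i=1..n. ?g (z i)) = label_lik n k p z * exp (- real (n_lab n z a))"
      using z by (simp add: prod.distrib label_lik_eq_prod exp_sum[symmetric] sum_negf del: of_bool_eq_1_iff)
    then have "exp (p a / 2 * real n) * (\<Prod>i=1..n. ?g (z i)) =
        label_lik n k p z * exp (p a / 2 * real n - real (n_lab n z a))"
      by (simp only: diff_conv_add_uminus exp_add mult_ac)
    moreover have "label_lik n k p z * 1 \<le> label_lik n k p z * exp (p a / 2 * real n - real (n_lab n z a))"
      using z label_lik_bounds[OF p, of n z] by (intro mult_left_mono) auto
    ultimately show "label_lik n k p z \<le> exp (p a / 2 * real n) * (\<Prod>i=1..n. ?g (z i))" by simp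
  qed
  also have "\<dots> \<le> (\<Sum>z\<in>labelings n k. exp (p a / 2 * real n) * (\<Prod>i=1..n. ?g (z i)))"
  proof (rule sum_mono2)
    show "0 \<le> exp (p a / 2 * real n) * (\<Prod>i=1..n. ?g (z i))" if "z \<in> labelings n k - ?S" for z
    proof -
      have "0 \<le> p (z i)" if "i \<in> {1..n}" for i
        using pD(1)[OF labelingsD[OF _ that]] \<open>z \<in> labelings n k - ?S\<close> by (auto simp: less_imp_le)
      then show ?thesis by (intro mult_nonneg_nonneg prod_nonneg) auto
    qed
  qed auto
  also have "\<dots> = exp (p a / 2 * real n) * (\<Sum>b=1..k. ?g b) ^ n"
    by (simp only: sum_distrib_left[symmetric] sum_labelings_prod[of ?g n k])
  also have "(\<Sum>b=1..k. ?g b) \<le> exp (- (3 / 5 * p a))"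
  proof -
    have "(\<Sum>b=1..k. ?g b) = p a * exp (- 1) + (\<Sum>b\<in>{1..k} - {a}. ?g b)"
      using a by (subst sum.remove[of _ a]) auto
    also have "(\<Sum>b\<in>{1..k} - {a}. ?g b) = (\<Sum>b\<in>{1..k} - {a}. p b)" by (intro sum.cong) auto
    also have "\<dots> = 1 - p a" using pD(3) a by (simp add: sum_diff1)
    finally have "(\<Sum>b=1..k. ?g b) = 1 + p a * exp (- 1) - p a" by simp
    moreover have "p a * exp (- 1) \<le> p a * (2 / 5)"
    proof (rule mult_left_mono)
      have "1 + 1 + 1\<^sup>2 / 2 \<le> exp (1 :: real)" by (rule exp_lower_Taylor_quadratic) simp
      then show "exp (- 1 :: real) \<le> 2 / 5" by (simp add: exp_minus field_simps)
    qed (use pD(1)[OF a] in simp)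
    ultimately have "(\<Sum>b=1..k. ?g b) \<le> 1 + (- (3 / 5 * p a))" by simp
    also have "\<dots> \<le> exp (- (3 / 5 * p a))" by (rule exp_ge_add_one_self)
    finally show ?thesis .
  qed
  then have "exp (p a / 2 * real n) * (\<Sum>b=1..k. ?g b) ^ n \<le> exp (p a / 2 * real n) * exp (- (3 / 5 * p a)) ^ n"
    using pD(1) by (intro mult_left_mono power_mono sum_nonneg) (auto simp: less_imp_le)
  also have "\<dots> = exp (- (p a / 10 * real n))"
    by (simp add: exp_of_nat_mult[symmetric] exp_add[symmetric] algebra_simps)
  finally show ?thesis .
qed

text \<open>On \<open>S\<close> the likelihood is at most the geometric mean of itself and
  \<open>H\<close> times some grid likelihood. As \<open>z\<close> and \<open>Q\<close> vary with
  \<open>x\<close>, all labels and grid points are summed, and extending the sum to all networks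
  leaves Bhattacharyya coefficients, each bounded through \<open>D\<close>.\<close>

lemma sum_cond_lik_le:
  assumes y: "y \<in> labelings n l" and P: "P \<in> edge_params l" and S: "S \<subseteq> networks n" and H: "0 \<le> H"
    and dom: "\<And>x. x \<in> S \<Longrightarrow> \<exists>z\<in>labelings n k. \<exists>Q\<in>edge_grid n k. cond_lik n l P x y \<le> H * cond_lik n k Q x z"
    and sep: "\<And>z Q. z \<in> labelings n k \<Longrightarrow> Q \<in> edge_grid n k \<Longrightarrow>
      D \<le> (\<Sum>e\<in>edges n. (sqrt (Q (z (fst e)) (z (snd e))) - sqrt (P (y (fst e)) (y (snd e))))\<^sup>2)"
  shows "(\<Sum>x\<in>S. cond_lik n l P x y) \<le>
    sqrt H * real k ^ n * real (2 * n) ^ card (class_pairs k) * exp (- (D / 2))"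
proof -
  let ?b = "\<lambda>x z Q. sqrt (cond_lik n k Q x z * cond_lik n l P x y)"
  have Q: "Q \<in> edge_params k" if "Q \<in> edge_grid n k" for Q using that edge_grid_subset by blast
  have b0: "0 \<le> ?b x z Q" if "Q \<in> edge_grid n k" for x z Q
    using cond_lik_bounds[OF P] cond_lik_bounds[OF Q[OF that]] by simp
  have "(\<Sum>x\<in>S. cond_lik n l P x y) \<le> (\<Sum>x\<in>S. \<Sum>z\<in>labelings n k. \<Sum>Q\<in>edge_grid n k. sqrt H * ?b x z Q)"
  proof (rule sum_mono)
    fix x assume "x \<in> S"
    from dom[OF this] obtain z R where zR: "z \<in> labelings n k" "R \<in> edge_grid n k"
      "cond_lik n l P x y \<le> H * cond_lik n k R x z" by blast
    have c0: "0 \<le> cond_lik n l P x y" by (rule cond_lik_bounds[OF P])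
    have "cond_lik n l P x y = sqrt (cond_lik n l P x y * cond_lik n l P x y)" using c0 by simp
    also have "\<dots> \<le> sqrt (H * cond_lik n k R x z * cond_lik n l P x y)"
      using zR(3) c0 by (intro real_sqrt_le_mono mult_right_mono) auto
    also have "\<dots> = sqrt H * ?b x z R" by (simp add: real_sqrt_mult)
    also have "\<dots> \<le> (\<Sum>Q\<in>edge_grid n k. sqrt H * ?b x z Q)"
      using zR(2) b0 H by (intro member_le_sum[of R _ "\<lambda>Q. sqrt H * ?b x z Q"]) auto
    also have "\<dots> \<le> (\<Sum>z\<in>labelings n k. \<Sum>Q\<in>edge_grid n k. sqrt H * ?b x z Q)"
      using zR(1) b0 H
      by (intro member_le_sum[of z _ "\<lambda>z. \<Sum>Q\<in>edge_grid n k. sqrt H * ?b x z Q"])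
         (auto intro!: sum_nonneg)
    finally show "cond_lik n l P x y \<le> (\<Sum>z\<in>labelings n k. \<Sum>Q\<in>edge_grid n k. sqrt H * ?b x z Q)" .
  qed
  also have "\<dots> \<le> (\<Sum>x\<in>networks n. \<Sum>z\<in>labelings n k. \<Sum>Q\<in>edge_grid n k. sqrt H * ?b x z Q)"
    using S H b0 by (intro sum_mono2) (auto intro!: sum_nonneg)
  also have "\<dots> = (\<Sum>z\<in>labelings n k. \<Sum>Q\<in>edge_grid n k. sqrt H * (\<Sum>x\<in>networks n. ?b x z Q))"
    by (subst sum.swap, subst sum.swap[of _ "edge_grid n k"]) (simp add: sum_distrib_left)
  also have "\<dots> \<le> (\<Sum>z\<in>labelings n k. \<Sum>Q\<in>edge_grid n k. sqrt H * exp (- (D / 2)))"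
  proof (intro sum_mono mult_left_mono)
    fix z R assume zR: "z \<in> labelings n k" "R \<in> edge_grid n k"
    have "(\<Sum>x\<in>networks n. ?b x z R) \<le> exp (- ((\<Sum>e\<in>edges n.
        (sqrt (R (z (fst e)) (z (snd e))) - sqrt (P (y (fst e)) (y (snd e))))\<^sup>2) / 2))"
      by (rule sum_sqrt_cond_lik_le[OF zR(1) Q[OF zR(2)] y P])
    also have "\<dots> \<le> exp (- (D / 2))" using sep[OF zR] by simp
    finally show "(\<Sum>x\<in>networks n. ?b x z R) \<le> exp (- (D / 2))" .
  qed (use H in simp)
  also have "\<dots> = real k ^ n * real (card (edge_grid n k)) * (sqrt H * exp (- (D / 2)))"
    by (simp add: card_labelings)
  also have "\<dots> \<le> real k ^ n * real (2 * n) ^ card (class_pairs k) * (sqrt H * exp (- (D / 2)))"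
    using card_edge_grid[of n k] H
    by (intro mult_right_mono mult_left_mono) (auto simp flip: of_nat_power of_nat_mult)
  finally show ?thesis by (simp add: mult_ac)
qed


section \<open>Losses of order exp(O(n)) when too few classes are selected\<close>

lemma powr_le_exp:
  assumes "1 \<le> n" "0 \<le> e"
  shows "real n powr e \<le> exp (e * real n)"
proof -
  have "ln (real n) \<le> real n" using assms ln_le_minus_one[of "real n"] by simp
  then show ?thesis using assms by (simp add: powr_def mult_left_mono)
qed

lemma pen_le_linear:
  assumes "1 \<le> n" "0 < \<epsilon>"
  shows "pen \<epsilon> k n \<le> ((\<Sum>i=1..k-1. (real i * (real i + 2) + 1 + \<epsilon>) / 2) + (\<Sum>i=1..k-1. ln (real i))) * real n"
proof -
  have "ln (real n) \<le> real n" using assms ln_le_minus_one[of "real n"] by simp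
  moreover define a where "a = (\<Sum>i=1..k-1. (real i * (real i + 2) + 1 + \<epsilon>) / 2)"
  moreover have "0 \<le> a" unfolding a_def using assms by (intro sum_nonneg) auto
  ultimately have "a * ln (real n) \<le> a * real n" by (intro mult_left_mono) auto
  moreover have "pen \<epsilon> k n = a * ln (real n) + real n * (\<Sum>i=1..k-1. ln (real i))"
    unfolding pen_def a_def sum_distrib_right ..
  ultimately show ?thesis unfolding a_def[symmetric] by (simp add: algebra_simps)
qed

lemma sum_UN_le:
  fixes f :: "'a \<Rightarrow> real"
  assumes "finite I" "\<And>i. i \<in> I \<Longrightarrow> finite (B i)" "\<And>y. 0 \<le> f y"
  shows "sum f (\<Union>i\<in>I. B i) \<le> (\<Sum>i\<in>I. sum f (B i))"
  using assms(1,2)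
proof (induction I rule: finite_induct)
  case (insert i I)
  have "sum f (B i \<union> \<Union> (B ` I)) + sum f (B i \<inter> \<Union> (B ` I)) = sum f (B i) + sum f (\<Union> (B ` I))"
    using insert by (intro sum.union_inter) auto
  moreover have "0 \<le> sum f (B i \<inter> \<Union> (B ` I))" using assms(3) by (intro sum_nonneg) auto
  ultimately show ?case using insert by fastforce
qed simp

lemma pen_nonneg:
  assumes "1 \<le> n" "0 < \<epsilon>" shows "0 \<le> pen \<epsilon> k n"
  unfolding pen_def using assms by (intro add_nonneg_nonneg mult_nonneg_nonneg sum_nonneg) auto

lemma card_class_pairs_le: "card (class_pairs k) \<le> k * k"
  using card_class_pairs[of k] by (cases k) auto

text \<open>A chain of comparisons: true conditional likelihood, maximum likelihood at
  \<open>k0\<close>, score at \<open>k0\<close>, score at the selected \<open>k\<close>, maximum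
  likelihood at \<open>k\<close>, grid likelihood. No link loses more than a factor exponential in
  \<open>n\<close>, which is affordable against \<open>n\<^sup>2 * \<rho> n\<close>.
  \<open>B\<close> is uniform in \<open>P\<close>, so it applies to parameters varying with
  \<open>n\<close>.\<close>

lemma selected_cond_lik_bound:
  assumes R: "normalised_score R" and zhat: "max_label_estimator zhat"
    and k0: "1 \<le> k0" and p: "p \<in> label_params k0" and \<epsilon>: "0 < \<epsilon>"
  shows "\<exists>B. \<forall>n\<ge>k0. \<forall>P\<in>edge_params k0. \<forall>x\<in>networks n. \<forall>y\<in>labelings n k0. \<forall>k.
    is_arg_max (\<lambda>k. ln (R n k x (zhat n k x)) - pen \<epsilon> k n) (\<lambda>k. 1 \<le> k \<and> k \<le> n) k \<longrightarrow> k \<le> k0 \<longrightarrow>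
    (\<exists>z\<in>labelings n k. \<exists>Q\<in>edge_grid n k. cond_lik n k0 P x y \<le> exp (B * real n) * cond_lik n k Q x z)"
proof -
  let ?e = "real (k0 * (k0 + 1)) / 2 + real (k0 - 1) / 2"
  obtain K where K: "0 < K" "\<And>n x z. 1 \<le> n \<Longrightarrow> x \<in> networks n \<Longrightarrow> z \<in> labelings n k0 \<Longrightarrow>
      0 < R n k0 x z \<and> max_complete_lik n k0 x z \<le> K * real n powr ?e * R n k0 x z"
    using normalised_scoreD(2)[OF R k0] by metis
  define q where "q = Min (p ` {1..k0})"
  have ne: "p ` {1..k0} \<noteq> {}" using k0 by simp
  have q0: "0 < q" unfolding q_def using label_paramsD(1)[OF p] by (subst Min_gr_iff[OF _ ne]) auto
  have qp: "q \<le> p a" if "a \<in> {1..k0}" for a unfolding q_def using that by (intro Min_le) auto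
  define Bp where "Bp = (\<Sum>i=1..k0-1. (real i * (real i + 2) + 1 + \<epsilon>) / 2) + (\<Sum>i=1..k0-1. ln (real i))"
  \<comment> \<open>In order: the constant and the power of \<open>n\<close> in the normaliser at
    \<open>k0\<close>, the penalty at \<open>k0\<close>, the grid loss \<open>exp 4\<close> per pair
    of classes, and the true label likelihood, which is at least \<open>q ^ n\<close>.\<close>
  define B where "B = K + ?e + Bp + 4 * real (k0 * k0) - ln q"
  have "\<exists>z\<in>labelings n k. \<exists>Q\<in>edge_grid n k. cond_lik n k0 P x y \<le> exp (B * real n) * cond_lik n k Q x z"
    if n: "k0 \<le> n" and P: "P \<in> edge_params k0" and x: "x \<in> networks n" and y: "y \<in> labelings n k0"
      and am: "is_arg_max (\<lambda>k. ln (R n k x (zhat n k x)) - pen \<epsilon> k n) (\<lambda>k. 1 \<le> k \<and> k \<le> n) k" and kk0: "k \<le> k0"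
    for n P x y k
  proof -
    have n1: "1 \<le> n" using n k0 by simp
    have k: "1 \<le> k" "k \<le> n" using am by (auto simp: is_arg_max_linorder)
    note z0 = max_label_estimatorD(1)[OF zhat n1 k0 x]
    note z = max_label_estimatorD(1)[OF zhat n1 k(1) x]
    have Rk: "0 < R n k x (zhat n k x)" "R n k x (zhat n k x) \<le> max_complete_lik n k x (zhat n k x)"
      using normalised_scoreD(2)[OF R k(1)] n1 x z by metis+
    obtain Q where Q: "Q \<in> edge_grid n k"
      "max_cond_lik n k x (zhat n k x) \<le> exp 4 ^ card (class_pairs k) * cond_lik n k Q x (zhat n k x)"
      using edge_grid_dominates[OF n1 x] by blast
    have Qe: "Q \<in> edge_params k" using Q(1) edge_grid_subset by blast
    note cQ = cond_lik_bounds(1)[OF Qe, of n x "zhat n k x"]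
    have lab: "exp (ln q * real n) \<le> label_lik n k0 p y"
    proof -
      have "exp (ln q * real n) = (\<Prod>i=1..n. q)"
        using q0 by (simp add: mult.commute[of "ln q"] exp_of_nat_mult)
      also have "\<dots> \<le> (\<Prod>i=1..n. p (y i))"
        using q0 qp labelingsD[OF y] by (intro prod_mono) (auto simp: less_imp_le)
      finally show ?thesis by (simp add: label_lik_eq_prod[OF y])
    qed
    have "ln (R n k0 x (zhat n k0 x)) - pen \<epsilon> k0 n \<le> ln (R n k x (zhat n k x)) - pen \<epsilon> k n"
      using am k0 n by (simp add: is_arg_max_linorder)
    then have "ln (R n k0 x (zhat n k0 x)) \<le> Bp * real n + ln (R n k x (zhat n k x))"
      using pen_le_linear[OF n1 \<epsilon>, of k0] pen_nonneg[OF n1 \<epsilon>, of k] unfolding Bp_def by linarith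
    then have "exp (ln (R n k0 x (zhat n k0 x))) \<le> exp (Bp * real n + ln (R n k x (zhat n k x)))" by simp
    then have RR: "R n k0 x (zhat n k0 x) \<le> exp (Bp * real n) * R n k x (zhat n k x)"
      using K(2)[OF n1 x z0] Rk(1) by (simp add: exp_add)
    have m: "max_complete_lik n k x (zhat n k x) \<le> exp (4 * real (k0 * k0) * real n) * cond_lik n k Q x (zhat n k x)"
    proof -
      have "max_complete_lik n k x (zhat n k x) \<le> max_cond_lik n k x (zhat n k x) * 1"
        unfolding max_complete_lik_eq[OF k(1)]
        using max_cond_lik_pos max_label_lik_bounds[OF k(1)] by (intro mult_left_mono) (auto simp: less_imp_le)
      also have "\<dots> \<le> exp 4 ^ card (class_pairs k) * cond_lik n k Q x (zhat n k x)" using Q(2) by simp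
      also have "\<dots> \<le> exp (4 * real (k0 * k0) * real n) * cond_lik n k Q x (zhat n k x)"
      proof (rule mult_right_mono[OF _ cQ])
        have "card (class_pairs k) \<le> k0 * k0"
          using card_class_pairs_le[of k] mult_le_mono[OF kk0 kk0] by linarith
        also have "\<dots> \<le> k0 * k0 * n" using n1 by simp
        finally have "real (card (class_pairs k)) \<le> real (k0 * k0) * real n"
          by (metis of_nat_le_iff of_nat_mult)
        then show "exp 4 ^ card (class_pairs k) \<le> exp (4 * real (k0 * k0) * real n)"
          by (simp add: exp_of_nat_mult[symmetric])
      qed
      finally show ?thesis .
    qed
    have Kn: "K * real n powr ?e \<le> exp (K * real n) * exp (?e * real n)"
    proof (rule mult_mono)
      show "real n powr ?e \<le> exp (?e * real n)" by (rule powr_le_exp[OF n1]) simp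
      have "K \<le> K * real n" using K(1) n1 by simp
      also have "\<dots> \<le> exp (K * real n)" using exp_ge_add_one_self[of "K * real n"] by linarith
      finally show "K \<le> exp (K * real n)" .
    qed (use K(1) in auto)
    have "cond_lik n k0 P x y * exp (ln q * real n) \<le> cond_lik n k0 P x y * label_lik n k0 p y"
      by (intro mult_left_mono lab cond_lik_bounds[OF P])
    also have "\<dots> \<le> max_complete_lik n k0 x y"
      using complete_lik_le_max[OF p P] by (simp add: complete_lik_def)
    also have "\<dots> \<le> max_complete_lik n k0 x (zhat n k0 x)"
      by (rule max_label_estimatorD(2)[OF zhat n1 k0 x y])
    also have "\<dots> \<le> (K * real n powr ?e) * R n k0 x (zhat n k0 x)"
      using K(2)[OF n1 x z0] by simp
    also have "\<dots> \<le> (exp (K * real n) * exp (?e * real n)) * (exp (Bp * real n) *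
        (exp (4 * real (k0 * k0) * real n) * cond_lik n k Q x (zhat n k x)))"
    proof (rule mult_mono[OF Kn])
      have "R n k0 x (zhat n k0 x) \<le> exp (Bp * real n) * R n k x (zhat n k x)" by (rule RR)
      also have "\<dots> \<le> exp (Bp * real n) * (exp (4 * real (k0 * k0) * real n) * cond_lik n k Q x (zhat n k x))"
        using Rk(2) m by (intro mult_left_mono) auto
      finally show "R n k0 x (zhat n k0 x) \<le>
          exp (Bp * real n) * (exp (4 * real (k0 * k0) * real n) * cond_lik n k Q x (zhat n k x))" .
    qed (use K(2)[OF n1 x z0] in auto)
    finally have "cond_lik n k0 P x y * exp (ln q * real n) * exp (- ln q * real n) \<le>
        (exp (K * real n) * exp (?e * real n)) * (exp (Bp * real n) *
        (exp (4 * real (k0 * k0) * real n) * cond_lik n k Q x (zhat n k x))) * exp (- ln q * real n)"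
      by (rule mult_right_mono) simp
    also have "cond_lik n k0 P x y * exp (ln q * real n) * exp (- ln q * real n) = cond_lik n k0 P x y"
      by (simp add: exp_minus)
    also have "(exp (K * real n) * exp (?e * real n)) * (exp (Bp * real n) *
        (exp (4 * real (k0 * k0) * real n) * cond_lik n k Q x (zhat n k x))) * exp (- ln q * real n) =
        exp (B * real n) * cond_lik n k Q x (zhat n k x)"
      unfolding B_def diff_conv_add_uminus distrib_right exp_add by (simp only: mult_ac)
    finally show ?thesis using z Q(1) by blast
  qed
  then show ?thesis by blast
qed

text \<open>The true labelings are split. Those with a class below half its expected size form
  \<open>A\<close> and have exponentially small probability. For the others
  \<open>label_separation\<close> with \<open>\<gamma> = g * n\<close> yields an exponent of order
  \<open>n\<^sup>2 * \<rho> n\<close>, which outweighs all losses.\<close>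

lemma underestimation:
  assumes R: "normalised_score R" and zhat: "max_label_estimator zhat"
    and k0: "1 \<le> k0" and p: "p \<in> label_params k0"
    and P: "\<And>n. 1 \<le> n \<Longrightarrow> P n \<in> edge_params k0" "\<And>n a b. P n a b = \<rho> n * S a b"
    and \<rho>: "\<And>n. 1 \<le> n \<Longrightarrow> 0 < \<rho> n" "filterlim (\<lambda>n. real n * \<rho> n) at_top sequentially"
    and S: "\<And>a b. a \<in> {1..k0} \<Longrightarrow> b \<in> {1..k0} \<Longrightarrow> a \<noteq> b \<Longrightarrow> \<exists>c\<in>{1..k0}. S c a \<noteq> S c b"
    and \<epsilon>: "0 < \<epsilon>"
    and khat: "\<And>n x. 1 \<le> n \<Longrightarrow> x \<in> networks n \<Longrightarrow>
      is_arg_max (\<lambda>k. ln (R n k x (zhat n k x)) - pen \<epsilon> k n) (\<lambda>k. 1 \<le> k \<and> k \<le> n) (khat n x)"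
  shows "\<exists>\<kappa>>0. \<forall>\<^sub>F n in sequentially.
    (\<Sum>x\<in>{x\<in>networks n. khat n x < k0}. net_prob n k0 p (P n) x) \<le> 2 * real k0 * exp (- \<kappa> * real n)"
proof -
  obtain B where B: "\<And>n P x y k. k0 \<le> n \<Longrightarrow> P \<in> edge_params k0 \<Longrightarrow> x \<in> networks n \<Longrightarrow> y \<in> labelings n k0 \<Longrightarrow>
    is_arg_max (\<lambda>k. ln (R n k x (zhat n k x)) - pen \<epsilon> k n) (\<lambda>k. 1 \<le> k \<and> k \<le> n) k \<Longrightarrow> k \<le> k0 \<Longrightarrow>
    \<exists>z\<in>labelings n k. \<exists>Q\<in>edge_grid n k. cond_lik n k0 P x y \<le> exp (B * real n) * cond_lik n k Q x z"
    using selected_cond_lik_bound[OF R zhat k0 p \<epsilon>] by blast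
  define q where "q = Min (p ` {1..k0})"
  have ne: "p ` {1..k0} \<noteq> {}" using k0 by simp
  have q0: "0 < q" unfolding q_def using label_paramsD(1)[OF p] by (subst Min_gr_iff[OF _ ne]) auto
  have qp: "q \<le> p a" if "a \<in> {1..k0}" for a unfolding q_def using that by (intro Min_le) auto
  have "q \<le> 1" using qp[of 1] label_paramsD(2)[OF p, of 1] k0 by simp
  \<comment> \<open>Taking roots before scaling makes the separation \<open>\<eta>\<close>
    independent of \<open>n\<close>.\<close>
  define \<sigma> where "\<sigma> = (\<lambda>a b. sqrt (S a b))"
  have \<sigma>: "sqrt (P n a b) = sqrt (\<rho> n) * \<sigma> a b" for n a b
    by (simp add: P(2) \<sigma>_def real_sqrt_mult)
  have Psym: "P n a b = P n b a" if "1 \<le> n" "a \<in> {1..k0}" "b \<in> {1..k0}" for n a b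
    by (rule edge_paramsD(3)[OF P(1)[OF that(1)] that(2,3)])
  have Ssym: "S a b = S b a" if "a \<in> {1..k0}" "b \<in> {1..k0}" for a b
    using Psym[of 1 a b] \<rho>(1)[of 1] that by (simp add: P(2))
  define W where "W = (\<lambda>(a, b, c). (\<sigma> a c - \<sigma> b c)\<^sup>2) ` ({1..k0} \<times> {1..k0} \<times> {1..k0}) - {0}"
  have W: "finite (insert 1 W)" "\<And>w. w \<in> insert 1 W \<Longrightarrow> 0 < w" by (auto simp: W_def less_le)
  \<comment> \<open>The least nonzero squared difference, capped at 1 so that the minimum also
    exists when there is none, as for \<open>k0 = 1\<close>.\<close>
  define \<eta> where "\<eta> = Min (insert 1 W)"
  have \<eta>0: "0 < \<eta>" unfolding \<eta>_def using W by (subst Min_gr_iff) auto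
  have \<eta>: "\<exists>c\<in>{1..k0}. \<eta> \<le> (\<sigma> a c - \<sigma> b c)\<^sup>2" if ab: "a \<in> {1..k0}" "b \<in> {1..k0}" "a \<noteq> b" for a b
  proof -
    obtain c where c: "c \<in> {1..k0}" "S c a \<noteq> S c b" using S[OF ab] by blast
    then have "\<sigma> a c \<noteq> \<sigma> b c" using Ssym ab c by (simp add: \<sigma>_def)
    then have "(\<sigma> a c - \<sigma> b c)\<^sup>2 \<in> W"
      using ab(1,2) c(1) unfolding W_def by (intro DiffI image_eqI[of _ _ "(a, b, c)"]) auto
    then have "\<eta> \<le> (\<sigma> a c - \<sigma> b c)\<^sup>2" unfolding \<eta>_def using W(1) by (intro Min_le) auto
    then show ?thesis using c(1) by blast
  qed
  \<comment> \<open>Half the least expected class size, \<open>q * n / 2\<close>, shared among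
    \<open>k0\<close> labels, as \<open>label_separation\<close> asks.\<close>
  define g where "g = q / (2 * real k0)"
  have g0: "0 < g" using q0 k0 by (simp add: g_def)
  \<comment> \<open>\<open>B / 2\<close> comes from \<open>sqrt H\<close>, \<open>ln k0\<close> from
    the union over labelings and \<open>2 * k0\<^sup>2\<close> from the union over the grid.
    \<open>C\<close> is chosen so that \<open>D / 2 = C * n\<^sup>2 * \<rho> n\<close>
    below.\<close>
  define B' where "B' = B / 2 + ln (real k0) + 2 * real (k0 * k0)"
  define C where "C = g\<^sup>2 * \<eta> / 16"
  have C0: "0 < C" using g0 \<eta>0 by (simp add: C_def)
  \<comment> \<open>The rate of \<open>label_lik_rare_class\<close>; it is at most 1, so the bound
    \<open>exp (- real n)\<close> for typical labelings fits under it.\<close>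
  define \<kappa> where "\<kappa> = q / 10"
  have \<kappa>: "0 < \<kappa>" "\<kappa> \<le> 1" using q0 \<open>q \<le> 1\<close> by (auto simp: \<kappa>_def)
  have ev: "\<forall>\<^sub>F n in sequentially. k0 \<le> n \<and> 2 \<le> g * real n \<and> (B' + 1) / C \<le> real n * \<rho> n"
  proof (intro eventually_conj)
    show "\<forall>\<^sub>F n in sequentially. k0 \<le> n" by (rule eventually_ge_at_top)
    show "\<forall>\<^sub>F n in sequentially. 2 \<le> g * real n"
      using filterlim_tendsto_pos_mult_at_top[OF tendsto_const g0 filterlim_real_sequentially]
      by (simp add: filterlim_at_top)
    show "\<forall>\<^sub>F n in sequentially. (B' + 1) / C \<le> real n * \<rho> n"
      using \<rho>(2) by (simp add: filterlim_at_top)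
  qed
  have "(\<Sum>x\<in>{x\<in>networks n. khat n x < k0}. net_prob n k0 p (P n) x) \<le> 2 * real k0 * exp (- \<kappa> * real n)"
    if n: "k0 \<le> n \<and> 2 \<le> g * real n \<and> (B' + 1) / C \<le> real n * \<rho> n" for n
  proof -
    have n1: "1 \<le> n" using n k0 by simp
    note P = P(1)[OF n1] and khat = khat[OF n1]
    let ?X = "{x\<in>networks n. khat n x < k0}"
    let ?rare = "\<lambda>a. {y\<in>labelings n k0. real (n_lab n y a) < p a / 2 * real n}"
    define A where "A = (\<Union>a\<in>{1..k0}. ?rare a)"
    have A: "A \<subseteq> labelings n k0" by (auto simp: A_def)
    have lab0: "0 \<le> label_lik n k0 p y" for y using label_lik_bounds(1)[OF p] by (simp add: less_imp_le)
    have cond0: "0 \<le> cond_lik n k0 (P n) x y" for x y by (rule cond_lik_bounds(1)[OF P])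
    have typical: "(\<Sum>x\<in>?X. cond_lik n k0 (P n) x y) \<le> real k0 * exp (- \<kappa> * real n)"
      if y: "y \<in> labelings n k0" "y \<notin> A" for y
    proof -
      have big: "g * real n * real k0 \<le> real (n_lab n y a)" if a: "a \<in> {1..k0}" for a
      proof -
        have "g * real n * real k0 = q / 2 * real n" using k0 by (simp add: g_def)
        also have "\<dots> \<le> p a / 2 * real n" using qp[OF a] by (intro mult_right_mono) auto
        also have "\<dots> \<le> real (n_lab n y a)" using y a by (auto simp: A_def not_less)
        finally show ?thesis .
      qed
      have one: "(\<Sum>x\<in>{x\<in>networks n. khat n x = k}. cond_lik n k0 (P n) x y) \<le> exp (- real n)"
        if k: "1 \<le> k" "k < k0" for k
      proof -
        define D where "D = (g * real n)\<^sup>2 * (\<rho> n * \<eta>) / 8"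
        have "(\<Sum>x\<in>{x\<in>networks n. khat n x = k}. cond_lik n k0 (P n) x y) \<le>
            sqrt (exp (B * real n)) * real k ^ n * real (2 * n) ^ card (class_pairs k) * exp (- (D / 2))"
        proof (rule sum_cond_lik_le[OF y(1) P])
          show "\<exists>z\<in>labelings n k. \<exists>Q\<in>edge_grid n k. cond_lik n k0 (P n) x y \<le> exp (B * real n) * cond_lik n k Q x z"
            if "x \<in> {x\<in>networks n. khat n x = k}" for x
            using B[of n "P n" x y k] n P that y(1) k khat by auto
          fix z Q assume z: "z \<in> labelings n k" and Q: "Q \<in> edge_grid n k"
          have Qe: "Q \<in> edge_params k" using Q edge_grid_subset by blast
          show "D \<le> (\<Sum>e\<in>edges n. (sqrt (Q (z (fst e)) (z (snd e))) - sqrt (P n (y (fst e)) (y (snd e))))\<^sup>2)"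
            unfolding D_def
          proof (rule label_separation[OF y(1) z k Qe, where T = "\<lambda>a b. sqrt (P n a b)"])
            show "sqrt (P n a b) = sqrt (P n b a)" if "a \<in> {1..k0}" "b \<in> {1..k0}" for a b
              using Psym[OF n1 that] by simp
            show "0 \<le> \<rho> n * \<eta>" using \<rho>(1)[OF n1] \<eta>0 by simp
            show "\<exists>c\<in>{1..k0}. \<rho> n * \<eta> \<le> (sqrt (P n a c) - sqrt (P n b c))\<^sup>2"
              if ab: "a \<in> {1..k0}" "b \<in> {1..k0}" "a \<noteq> b" for a b
            proof -
              obtain c where c: "c \<in> {1..k0}" "\<eta> \<le> (\<sigma> a c - \<sigma> b c)\<^sup>2" using \<eta>[OF ab] by blast
              have "(sqrt (P n a c) - sqrt (P n b c))\<^sup>2 = \<rho> n * (\<sigma> a c - \<sigma> b c)\<^sup>2"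
                unfolding \<sigma> right_diff_distrib[symmetric] power_mult_distrib
                using \<rho>(1)[OF n1] by simp
              then show ?thesis using c \<rho>(1)[OF n1] by (intro bexI[of _ c]) auto
            qed
            show "2 \<le> g * real n" using n by simp
          qed (use big in auto)
        qed auto
        also have "\<dots> \<le> exp (B / 2 * real n) * exp (ln (real k0) * real n) * exp (2 * real (k0 * k0) * real n) * exp (- (D / 2))"
        proof (intro mult_right_mono mult_mono)
          have "sqrt (exp (B * real n)) = sqrt (exp (B / 2 * real n) * exp (B / 2 * real n))"
            by (simp add: exp_add[symmetric])
          then show "sqrt (exp (B * real n)) \<le> exp (B / 2 * real n)" by simp
          have "real k ^ n \<le> real k0 ^ n" using k by (intro power_mono) auto
          also have "\<dots> = exp (ln (real k0) * real n)"
            using k0 by (simp add: mult.commute[of "ln _"] exp_of_nat_mult)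
          finally show "real k ^ n \<le> exp (ln (real k0) * real n)" .
          have "card (class_pairs k) \<le> k0 * k0"
            using card_class_pairs_le[of k] mult_le_mono[of k k0 k k0] k by linarith
          then have "real (2 * n) ^ card (class_pairs k) \<le> real (2 * n) ^ (k0 * k0)"
            using n1 by (intro power_increasing) auto
          also have "\<dots> \<le> exp (real (2 * n)) ^ (k0 * k0)"
            using exp_ge_add_one_self[of "real (2 * n)"] by (intro power_mono) linarith+
          also have "\<dots> = exp (2 * real (k0 * k0) * real n)"
            by (simp add: exp_of_nat_mult[symmetric] mult_ac)
          finally show "real (2 * n) ^ card (class_pairs k) \<le> exp (2 * real (k0 * k0) * real n)" .
        qed auto
        also have "\<dots> = exp (B' * real n - D / 2)"
          unfolding B'_def diff_conv_add_uminus distrib_right exp_add by simp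
        also have "\<dots> \<le> exp (- real n)"
        proof -
          have "B' + 1 \<le> C * (real n * \<rho> n)" using n C0 by (simp add: pos_divide_le_eq mult.commute)
          then have "(B' + 1) * real n \<le> C * (real n * \<rho> n) * real n" by (intro mult_right_mono) auto
          also have "\<dots> = D / 2" by (simp add: C_def D_def power2_eq_square)
          finally show ?thesis by (simp add: algebra_simps)
        qed
        finally show ?thesis .
      qed
      have "(\<Sum>x\<in>?X. cond_lik n k0 (P n) x y) =
          (\<Sum>k\<in>{1..<k0}. \<Sum>x\<in>{x\<in>?X. khat n x = k}. cond_lik n k0 (P n) x y)"
        using khat by (intro sum.group[symmetric]) (auto simp: is_arg_max_linorder)
      also have "\<dots> \<le> (\<Sum>k\<in>{1..<k0}. exp (- real n))"
      proof (rule sum_mono)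
        fix k assume k: "k \<in> {1..<k0}"
        have "{x\<in>?X. khat n x = k} = {x\<in>networks n. khat n x = k}" using k by auto
        then show "(\<Sum>x\<in>{x\<in>?X. khat n x = k}. cond_lik n k0 (P n) x y) \<le> exp (- real n)"
          using one[of k] k by simp
      qed
      also have "\<dots> \<le> real k0 * exp (- \<kappa> * real n)"
        using \<kappa> mult_right_mono[of \<kappa> 1 "real n"] by (simp add: mult_mono)
      finally show ?thesis .
    qed
    have "(\<Sum>x\<in>?X. net_prob n k0 p (P n) x) =
        (\<Sum>y\<in>labelings n k0. label_lik n k0 p y * (\<Sum>x\<in>?X. cond_lik n k0 (P n) x y))"
      unfolding net_prob_def complete_lik_def
      by (subst sum.swap) (simp add: sum_distrib_left mult.commute)
    also have "\<dots> = (\<Sum>y\<in>labelings n k0 - A. label_lik n k0 p y * (\<Sum>x\<in>?X. cond_lik n k0 (P n) x y)) +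
        (\<Sum>y\<in>A. label_lik n k0 p y * (\<Sum>x\<in>?X. cond_lik n k0 (P n) x y))"
      by (rule sum.subset_diff[OF A finite_labelings])
    also have "\<dots> \<le> real k0 * exp (- \<kappa> * real n) + real k0 * exp (- \<kappa> * real n)"
    proof (rule add_mono)
      have "(\<Sum>y\<in>labelings n k0 - A. label_lik n k0 p y * (\<Sum>x\<in>?X. cond_lik n k0 (P n) x y)) \<le>
          (\<Sum>y\<in>labelings n k0 - A. label_lik n k0 p y * (real k0 * exp (- \<kappa> * real n)))"
        using typical lab0 by (intro sum_mono mult_left_mono) auto
      also have "\<dots> \<le> (\<Sum>y\<in>labelings n k0. label_lik n k0 p y * (real k0 * exp (- \<kappa> * real n)))"
        using lab0 by (intro sum_mono2) auto
      also have "\<dots> = real k0 * exp (- \<kappa> * real n)"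
        using sum_labelings_label_lik[OF label_paramsD(3)[OF p], of n] by (simp add: sum_distrib_right[symmetric])
      finally show "(\<Sum>y\<in>labelings n k0 - A. label_lik n k0 p y * (\<Sum>x\<in>?X. cond_lik n k0 (P n) x y)) \<le>
          real k0 * exp (- \<kappa> * real n)" .
      have "(\<Sum>y\<in>A. label_lik n k0 p y * (\<Sum>x\<in>?X. cond_lik n k0 (P n) x y)) \<le> (\<Sum>y\<in>A. label_lik n k0 p y * 1)"
      proof (intro sum_mono mult_left_mono lab0)
        fix y assume "y \<in> A"
        then have y: "y \<in> labelings n k0" using A by blast
        have "(\<Sum>x\<in>?X. cond_lik n k0 (P n) x y) \<le> (\<Sum>x\<in>networks n. cond_lik n k0 (P n) x y)"
          using cond0 by (intro sum_mono2) auto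
        then show "(\<Sum>x\<in>?X. cond_lik n k0 (P n) x y) \<le> 1" using sum_networks_cond_lik[OF y P] by simp
      qed
      also have "\<dots> \<le> (\<Sum>a\<in>{1..k0}. \<Sum>y\<in>?rare a. label_lik n k0 p y)"
        unfolding A_def mult_1_right using lab0 by (intro sum_UN_le) auto
      also have "\<dots> \<le> (\<Sum>a\<in>{1..k0}. exp (- \<kappa> * real n))"
      proof (rule sum_mono)
        fix a assume a: "a \<in> {1..k0}"
        have "\<kappa> * real n \<le> p a / 10 * real n" using qp[OF a] by (intro mult_right_mono) (auto simp: \<kappa>_def)
        then show "(\<Sum>y\<in>?rare a. label_lik n k0 p y) \<le> exp (- \<kappa> * real n)"
          using label_lik_rare_class[OF p a, of n] by (smt (verit) exp_le_cancel_iff mult_minus_left)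
      qed
      finally show "(\<Sum>y\<in>A. label_lik n k0 p y * (\<Sum>x\<in>?X. cond_lik n k0 (P n) x y)) \<le>
          real k0 * exp (- \<kappa> * real n)" by simp
    qed
    finally show ?thesis by simp
  qed
  then show ?thesis by (intro exI[of _ \<kappa>] conjI \<kappa>(1) eventually_mono[OF ev])
qed


subsection \<open>Consistency\<close>

text \<open>Both error probabilities are summable, and the first Borel-Cantelli lemma then applies
  to any coupling of the networks for different \<open>n\<close>.\<close>

lemma score_estimator_consistent:
  assumes M: "prob_space M" and R: "normalised_score R" and zhat: "max_label_estimator zhat"
    and k0: "1 \<le> k0" and p: "p \<in> label_params k0"
    and P: "\<And>n. 1 \<le> n \<Longrightarrow> P n \<in> edge_params k0" "\<And>n a b. P n a b = \<rho> n * S a b"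
    and \<rho>: "\<And>n. 1 \<le> n \<Longrightarrow> 0 < \<rho> n" "filterlim (\<lambda>n. real n * \<rho> n) at_top sequentially"
    and S: "\<And>a b. a \<in> {1..k0} \<Longrightarrow> b \<in> {1..k0} \<Longrightarrow> a \<noteq> b \<Longrightarrow> \<exists>c\<in>{1..k0}. S c a \<noteq> S c b"
    and A: "\<And>n. 1 \<le> n \<Longrightarrow> sbm_network M n k0 p (P n) (A n)"
    and \<epsilon>: "0 < \<epsilon>"
    and khat: "\<And>n x. 1 \<le> n \<Longrightarrow> x \<in> networks n \<Longrightarrow>
      is_arg_max (\<lambda>k. ln (R n k x (zhat n k x)) - pen \<epsilon> k n) (\<lambda>k. 1 \<le> k \<and> k \<le> n) (khat n x)"
  shows "AE w in M. \<exists>N. \<forall>n\<ge>N. khat n (A n w) = k0"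
proof -
  interpret prob_space M by (rule M)
  obtain K where over: "\<And>n. k0 \<le> n \<Longrightarrow> (\<Sum>x\<in>{x\<in>networks n. k0 < khat n x}. net_prob n k0 p (P n) x)
      \<le> K * real n powr (- 1 - \<epsilon> / 2)"
  proof -
    have "\<exists>K. \<forall>n\<ge>k0. (\<Sum>x\<in>{x\<in>networks n. k0 < khat n x}. net_prob n k0 p (P n) x)
        \<le> K * real n powr (- 1 - \<epsilon> / 2)"
      by (rule overestimation[where P = P and khat = khat, OF R zhat k0 p]) (fact P(1) \<epsilon> khat)+
    then show thesis using that by blast
  qed
  obtain \<kappa> where \<kappa>: "0 < \<kappa>" and under: "\<forall>\<^sub>F n in sequentially.
      (\<Sum>x\<in>{x\<in>networks n. khat n x < k0}. net_prob n k0 p (P n) x) \<le> 2 * real k0 * exp (- \<kappa> * real n)"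
  proof -
    have "\<exists>\<kappa>>0. \<forall>\<^sub>F n in sequentially.
        (\<Sum>x\<in>{x\<in>networks n. khat n x < k0}. net_prob n k0 p (P n) x) \<le> 2 * real k0 * exp (- \<kappa> * real n)"
      by (rule underestimation[where P = P and \<rho> = \<rho> and S = S and khat = khat, OF R zhat k0 p])
         (fact P \<rho> S \<epsilon> khat)+
    then show thesis using that by blast
  qed
  \<comment> \<open>The model is prescribed from \<open>n = 1\<close> on, so the event at 0 is set
    to be empty and the final threshold is \<open>max 1 N\<close>.\<close>
  define E where "E = (\<lambda>n. if n = 0 then {} else {w\<in>space M. A n w \<in> {x\<in>networks n. khat n x \<noteq> k0}})"
  have E: "E n \<in> sets M" for n
    using prob_sbm_network(1)[OF M A p P(1), of n "{x\<in>networks n. khat n x \<noteq> k0}"] by (cases "n = 0") (auto simp: E_def)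
  have probE: "measure M (E n) = (\<Sum>x\<in>{x\<in>networks n. khat n x \<noteq> k0}. net_prob n k0 p (P n) x)" if "1 \<le> n" for n
    using prob_sbm_network(2)[OF M A p P(1), of n "{x\<in>networks n. khat n x \<noteq> k0}"] that by (simp add: E_def)
  have "summable (\<lambda>n. measure M (E n))"
  proof (rule summable_comparison_test_ev)
    have "\<forall>\<^sub>F n in sequentially. k0 \<le> n" by (rule eventually_ge_at_top)
    with under show "\<forall>\<^sub>F n in sequentially. norm (measure M (E n)) \<le>
        2 * real k0 * exp (- \<kappa> * real n) + K * real n powr (- 1 - \<epsilon> / 2)"
    proof eventually_elim
      case (elim n)
      have "{x\<in>networks n. khat n x \<noteq> k0} = {x\<in>networks n. khat n x < k0} \<union> {x\<in>networks n. k0 < khat n x}"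
        by auto
      then have "measure M (E n) = (\<Sum>x\<in>{x\<in>networks n. khat n x < k0}. net_prob n k0 p (P n) x) +
          (\<Sum>x\<in>{x\<in>networks n. k0 < khat n x}. net_prob n k0 p (P n) x)"
        using probE[of n] elim k0 by (subst sum.union_disjoint[symmetric]) auto
      then have "measure M (E n) \<le> 2 * real k0 * exp (- \<kappa> * real n) + K * real n powr (- 1 - \<epsilon> / 2)"
        using elim over[of n] by linarith
      then show ?case by simp
    qed
    show "summable (\<lambda>n. 2 * real k0 * exp (- \<kappa> * real n) + K * real n powr (- 1 - \<epsilon> / 2))"
    proof (intro summable_add summable_mult)
      have "exp (- \<kappa> * real n) = exp (- \<kappa>) ^ n" for n by (simp add: exp_of_nat_mult[symmetric] mult.commute)
      moreover have "summable (\<lambda>n. exp (- \<kappa>) ^ n)" using \<kappa> by (intro summable_geometric) simp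
      ultimately show "summable (\<lambda>n. exp (- \<kappa> * real n))" by simp
      show "summable (\<lambda>n. real n powr (- 1 - \<epsilon> / 2))" using \<epsilon> by (simp add: summable_real_powr_iff)
    qed
  qed
  then have "AE w in M. \<forall>\<^sub>F n in sequentially. w \<in> space M - E n"
    using E by (intro borel_cantelli_AE1) (auto simp: emeasure_eq_measure)
  then show ?thesis
  proof (rule AE_mp, intro AE_I2 impI)
    fix w assume w: "w \<in> space M" "\<forall>\<^sub>F n in sequentially. w \<in> space M - E n"
    then obtain N where N: "\<And>n. N \<le> n \<Longrightarrow> w \<notin> E n" by (auto simp: eventually_sequentially)
    have "khat n (A n w) = k0" if "max 1 N \<le> n" for n
    proof -
      have "A n w \<in> networks n"
        using A[of n] that w(1) by (auto simp: sbm_network_def dest: measurable_space)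
      then show ?thesis using N[of n] that w(1) by (auto simp: E_def)
    qed
    then show "\<exists>N. \<forall>n\<ge>N. khat n (A n w) = k0" by blast
  qed
qed

theorem theorem3p2:
  fixes M :: "'w measure"
    and A :: "nat \<Rightarrow> 'w \<Rightarrow> nat \<Rightarrow> nat \<Rightarrow> nat"
    and k0 :: nat
    and \<pi>0 :: "nat \<Rightarrow> real"
    and S0 :: "nat \<Rightarrow> nat \<Rightarrow> real"
    and P0 :: "nat \<Rightarrow> nat \<Rightarrow> nat \<Rightarrow> real"
    and \<rho> :: "nat \<Rightarrow> real"
    and \<epsilon> :: real
    and zhat :: "nat \<Rightarrow> nat \<Rightarrow> (nat \<Rightarrow> nat \<Rightarrow> nat) \<Rightarrow> nat \<Rightarrow> nat"
    and khat_DNML khat_NMCL :: "nat \<Rightarrow> (nat \<Rightarrow> nat \<Rightarrow> nat) \<Rightarrow> nat"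
  assumes "prob_space M"
    and "k0 \<ge> 1"
    and "\<pi>0 \<in> label_params k0"
    and "\<And>n a b. P0 n a b = \<rho> n * S0 a b"
    and "\<And>n. n \<ge> 1 \<Longrightarrow> \<rho> n > 0"
    and "\<And>n. n \<ge> 1 \<Longrightarrow> P0 n \<in> edge_params k0"
    and "\<And>n a b. \<lbrakk>n \<ge> 1; a \<in> {1..k0}; b \<in> {1..k0}; a \<noteq> b\<rbrakk> \<Longrightarrow> \<exists>c\<in>{1..k0}. P0 n c a \<noteq> P0 n c b"
    and "(\<rho> \<longlonglongrightarrow> 0 \<and> filterlim (\<lambda>n. real n * \<rho> n) at_top sequentially) \<or> (\<forall>n\<ge>1. \<rho> n = 1)"
    and "\<And>n. n \<ge> 1 \<Longrightarrow> sbm_network M n k0 \<pi>0 (P0 n) (A n)"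
    and "\<epsilon> > 0"
    and "max_label_estimator zhat"
    and "\<And>n x. \<lbrakk>n \<ge> 1; x \<in> networks n\<rbrakk> \<Longrightarrow>
           is_arg_max (\<lambda>k. ln (DNML n k x (zhat n k x)) - pen \<epsilon> k n) (\<lambda>k. 1 \<le> k \<and> k \<le> n)
             (khat_DNML n x)"
    and "\<And>n x. \<lbrakk>n \<ge> 1; x \<in> networks n\<rbrakk> \<Longrightarrow>
           is_arg_max (\<lambda>k. ln (NMCL n k x (zhat n k x)) - pen \<epsilon> k n) (\<lambda>k. 1 \<le> k \<and> k \<le> n)
             (khat_NMCL n x)"
  shows "(AE w in M. \<exists>N. \<forall>n\<ge>N. khat_DNML n (A n w) = k0) \<and>
         (AE w in M. \<exists>N. \<forall>n\<ge>N. khat_NMCL n (A n w) = k0)"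
proof -
  have S: "\<exists>c\<in>{1..k0}. S0 c a \<noteq> S0 c b" if "a \<in> {1..k0}" "b \<in> {1..k0}" "a \<noteq> b" for a b
    using assms(7)[of 1 a b] that by (auto simp: assms(4))
  \<comment> \<open>In the dense regime \<open>n * \<rho> n\<close> equals \<open>n\<close>, so both
    regimes are treated at once.\<close>
  have \<rho>: "filterlim (\<lambda>n. real n * \<rho> n) at_top sequentially"
    using assms(8)
  proof
    assume "\<forall>n\<ge>1. \<rho> n = 1"
    then have "\<forall>\<^sub>F n in sequentially. real n = real n * \<rho> n"
      unfolding eventually_sequentially by (intro exI[of _ 1]) simp
    then show ?thesis
      using filterlim_real_sequentially filterlim_cong[OF refl refl] by fast
  qed simp
  show ?thesis
  proof
    show "AE w in M. \<exists>N. \<forall>n\<ge>N. khat_DNML n (A n w) = k0"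
      by (rule score_estimator_consistent[where P = P0 and \<rho> = \<rho> and S = S0 and A = A and khat = khat_DNML,
            OF assms(1) normalised_score_DNML assms(11,2,3)])
         (fact assms \<rho> S)+
    show "AE w in M. \<exists>N. \<forall>n\<ge>N. khat_NMCL n (A n w) = k0"
      by (rule score_estimator_consistent[where P = P0 and \<rho> = \<rho> and S = S0 and A = A and khat = khat_NMCL,
            OF assms(1) normalised_score_NMCL assms(11,2,3)])
         (fact assms \<rho> S)+
  qed
qed

end
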